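(* Let $A$ be a maximal monotone operator on $H$ with $0\in\mathrm{Rg}(A)$. Suppose $\phi:H\to\mathbb R\cup\{+\infty\}$ is convex, proper and lower semicontinuous such that $A$ is $\partial_H\phi$-monotone. Then for every $0<s<1$, the Dirichlet-to-Neumann operator $\Theta_s$ is $\partial_H\phi$-monotone.
   Context: $H$ is a real Hilbert space with inner product $(\cdot,\cdot)_H$. A (possibly multivalued, nonlinear) operator $A:D(A)\to2^H$ is identified with its graph; $D(A)=\{u:Au\neq\emptyset\}$, $\mathrm{Rg}(A)=\bigcup_{u\in D(A)}Au$. $A$ is monotone if $(\hat v-v,\hat u-u)_H\ge0$ for all $(u,v),(\hat u,\hat v)\in A$, and maximal monotone if also $\mathrm{Rg}(I+A)=H$. An operator $B$ on $H$ is $\partial_H\phi$-monotone if for every $\lambda>0$ the resolvent $J^B_\lambda=(I+\lambda B)^{-1}$ satisfies $\phi(J^B_\lambda u-J^B_\lambda\hat u)\le\phi(u-\hat u)$ for all $u,\hat u\in\mathrm{Rg}(I+\lambda B)$. A strong solution of $-z^{-\frac{1-2s}{s}}v''+Av\ni0$ is a function $v:[0,+\infty)\to H$ with $v\in W^{2,2}_{loc}((0,+\infty);H)$ such that for a.e. $z>0$, $v(z)\in D(A)$ and $z^{-\frac{1-2s}{s}}v''(z)\in A(v(z))$. The operator $\Theta_s$ is the set of all $(\varphi,w)\in H\times H$ for which there is a strong solution $v\in L^\infty(0,+\infty;H)\cap C^1([0,+\infty);H)$ with $v(0)=\varphi$ and $w=-(2s)^{1-2s}v'(0)$. *)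

theory Defs
  imports "HOL-Analysis.Analysis"
begin

section \<open>Operators as graphs\<close>

text \<open>A multivalued operator is its graph, so \<^const>\<open>Domain\<close> and \<^const>\<open>Range\<close> are $D(A)$ and
  $\mathrm{Rg}(A)$.\<close>

definition monotone_op :: "('h::real_inner \<times> 'h) set \<Rightarrow> bool" where
  "monotone_op A \<longleftrightarrow> (\<forall>(u, v)\<in>A. \<forall>(u', v')\<in>A. inner (v' - v) (u' - u) \<ge> 0)"

definition id_plus :: "real \<Rightarrow> ('h::real_vector \<times> 'h) set \<Rightarrow> ('h \<times> 'h) set" where
  "id_plus \<mu> B = {(u, u + \<mu> *\<^sub>R w) | u w. (u, w) \<in> B}"

definition maximal_monotone_op :: "('h::real_inner \<times> 'h) set \<Rightarrow> bool" where
  "maximal_monotone_op A \<longleftrightarrow> monotone_op A \<and> Range (id_plus 1 A) = UNIV"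

definition resolvent :: "real \<Rightarrow> ('h::real_vector \<times> 'h) set \<Rightarrow> ('h \<times> 'h) set" where
  "resolvent \<mu> B = (id_plus \<mu> B)\<inverse>"

text \<open>The resolvent of an arbitrary operator may be multivalued; the inequality is then required of
  every choice of values \<open>x\<close> at \<open>u\<close> and \<open>x'\<close> at \<open>u'\<close>. The domain of \<open>resolvent \<mu> B\<close> is
  the range of \<open>id_plus \<mu> B\<close>.\<close>

definition subdiff_monotone :: "('h::real_vector \<Rightarrow> ereal) \<Rightarrow> ('h \<times> 'h) set \<Rightarrow> bool" where
  "subdiff_monotone \<phi> B \<longleftrightarrow>
    (\<forall>\<mu>>0. \<forall>(u, x)\<in>resolvent \<mu> B. \<forall>(u', x')\<in>resolvent \<mu> B. \<phi> (x - x') \<le> \<phi> (u - u'))"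

section \<open>Extended-valued functionals\<close>

definition proper_fun :: "('h \<Rightarrow> ereal) \<Rightarrow> bool" where
  "proper_fun \<phi> \<longleftrightarrow> (\<forall>x. \<phi> x \<noteq> -\<infinity>) \<and> (\<exists>x. \<phi> x \<noteq> \<infinity>)"

definition convex_fun :: "('h::real_vector \<Rightarrow> ereal) \<Rightarrow> bool" where
  "convex_fun \<phi> \<longleftrightarrow> (\<forall>x y a b. a \<ge> 0 \<longrightarrow> b \<ge> 0 \<longrightarrow> a + b = 1 \<longrightarrow>
     \<phi> (a *\<^sub>R x + b *\<^sub>R y) \<le> ereal a * \<phi> x + ereal b * \<phi> y)"

definition lsc_fun :: "('h::topological_space \<Rightarrow> ereal) \<Rightarrow> bool" where
  "lsc_fun \<phi> \<longleftrightarrow> (\<forall>x. \<phi> x \<le> Liminf (at x) \<phi>)"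

section \<open>Vector-valued function spaces\<close>

text \<open>The library's \<^const>\<open>has_bochner_integral\<close> is restricted to second countable spaces. As
  the Hilbert space need not be separable, strong measurability and the Bochner integral are
  defined here without that restriction, from the same simple functions.\<close>

definition strongly_measurable :: "'a measure \<Rightarrow> ('a \<Rightarrow> 'b::real_normed_vector) \<Rightarrow> bool" where
  "strongly_measurable M f \<longleftrightarrow>
    (\<exists>S. (\<forall>i::nat. simple_function M (S i)) \<and> (AE x in M. (\<lambda>i. S i x) \<longlonglongrightarrow> f x))"

definition has_strong_bochner_integral ::
    "'a measure \<Rightarrow> ('a \<Rightarrow> 'b::real_normed_vector) \<Rightarrow> 'b \<Rightarrow> bool" where
  "has_strong_bochner_integral M f y \<longleftrightarrow> strongly_measurable M f \<and>
    (\<exists>S. (\<forall>i::nat. Bochner_Integration.simple_bochner_integrable M (S i)) \<and>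
      (\<lambda>i. \<integral>\<^sup>+x. ennreal (norm (f x - S i x)) \<partial>M) \<longlonglongrightarrow> 0 \<and>
      (\<lambda>i. Bochner_Integration.simple_bochner_integral M (S i)) \<longlonglongrightarrow> y)"

definition L2_loc :: "real set \<Rightarrow> (real \<Rightarrow> 'b::real_normed_vector) \<Rightarrow> bool" where
  "L2_loc I f \<longleftrightarrow> strongly_measurable (lebesgue_on I) f \<and>
    (\<forall>K. compact K \<longrightarrow> K \<subseteq> I \<longrightarrow> (\<integral>\<^sup>+t. ennreal ((norm (f t))\<^sup>2) \<partial>lebesgue_on K) < \<infinity>)"

definition Linf :: "real set \<Rightarrow> (real \<Rightarrow> 'b::real_normed_vector) \<Rightarrow> bool" where
  "Linf I f \<longleftrightarrow> strongly_measurable (lebesgue_on I) f \<and>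
    (\<exists>C. AE t in lebesgue_on I. norm (f t) \<le> C)"

definition test_function :: "real set \<Rightarrow> (real \<Rightarrow> real) \<Rightarrow> bool" where
  "test_function I \<psi> \<longleftrightarrow> (\<forall>n t. (deriv ^^ n) \<psi> field_differentiable (at t)) \<and>
    (\<exists>K. compact K \<and> K \<subseteq> I \<and> (\<forall>t. t \<notin> K \<longrightarrow> \<psi> t = 0))"

text \<open>That is, $\int_I \psi' f = -\int_I \psi g$ for all test functions; both Bochner integrals exist
  whenever \<open>f\<close> and \<open>g\<close> are locally integrable.\<close>

definition weak_deriv ::
    "real set \<Rightarrow> (real \<Rightarrow> 'b::real_normed_vector) \<Rightarrow> (real \<Rightarrow> 'b) \<Rightarrow> bool" where
  "weak_deriv I f g \<longleftrightarrow> (\<forall>\<psi>. test_function I \<psi> \<longrightarrow>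
    (\<exists>y. has_strong_bochner_integral (lebesgue_on I) (\<lambda>t. deriv \<psi> t *\<^sub>R f t) y \<and>
         has_strong_bochner_integral (lebesgue_on I) (\<lambda>t. \<psi> t *\<^sub>R g t) (- y)))"

text \<open>\<open>W22_loc I v v' v''\<close>: \<open>v\<close> belongs to $W^{2,2}_{loc}(I)$ with first and second weak derivatives
  \<open>v'\<close> and \<open>v''\<close> (which are unique almost everywhere).\<close>

definition W22_loc ::
    "real set \<Rightarrow> (real \<Rightarrow> 'b::real_normed_vector) \<Rightarrow> (real \<Rightarrow> 'b) \<Rightarrow> (real \<Rightarrow> 'b) \<Rightarrow> bool" where
  "W22_loc I v v' v'' \<longleftrightarrow> L2_loc I v \<and> L2_loc I v' \<and> L2_loc I v'' \<and>
    weak_deriv I v v' \<and> weak_deriv I v' v''"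

text \<open>\<open>v'\<close> is the classical derivative of \<open>v\<close> on \<open>S\<close>, one-sided at boundary points of an interval;
  \<^const>\<open>C1_differentiable_on\<close> would use two-sided derivatives instead.\<close>

definition C1_on :: "real set \<Rightarrow> (real \<Rightarrow> 'b::real_normed_vector) \<Rightarrow> (real \<Rightarrow> 'b) \<Rightarrow> bool" where
  "C1_on S v v' \<longleftrightarrow>
    (\<forall>z\<in>S. (v has_vector_derivative v' z) (at z within S)) \<and> continuous_on S v'"

section \<open>The Dirichlet-to-Neumann operator\<close>

text \<open>Functions on $[0,\infty)$ are total functions on the reals whose values at negative arguments
  are never used.\<close>

definition strong_solution :: "('h::real_inner \<times> 'h) set \<Rightarrow> real \<Rightarrow> (real \<Rightarrow> 'h) \<Rightarrow> bool" where
  "strong_solution A s v \<longleftrightarrow> (\<exists>v' v''. W22_loc {0<..} v v' v'' \<and>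
    (AE z in lebesgue_on {0<..}. v z \<in> Domain A \<and>
       (v z, (z powr (- ((1 - 2 * s) / s))) *\<^sub>R v'' z) \<in> A))"

definition DtN :: "('h::real_inner \<times> 'h) set \<Rightarrow> real \<Rightarrow> ('h \<times> 'h) set" where
  "DtN A s = {(f, w). \<exists>v v'. strong_solution A s v \<and> Linf {0<..} v \<and> C1_on {0..} v v' \<and>
     v 0 = f \<and> w = - (((2 * s) powr (1 - 2 * s)) *\<^sub>R v' 0)}"

end

theory Submission
  imports Defs "HOL-Computational_Algebra.Polynomial"
begin

text \<open>
  Let \<open>d\<close> be the difference of two bounded strong solutions. Formally, if \<open>\<phi>\<close> is smooth, then
  \<open>\<partial>\<phi>\<close>-monotonicity of \<open>A\<close> says that \<open>\<nabla>\<phi>(u - u') \<bullet> (w - w') \<ge> 0\<close> for \<open>(u, w), (u', w') \<in> A\<close>, so the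
  equation gives \<open>\<nabla>\<phi>(d) \<bullet> d'' \<ge> 0\<close>, the weight in front of the second derivative being a positive
  number. With the convexity of \<open>\<phi>\<close> this makes \<open>\<phi> \<circ> d\<close> a convex function on the half line. It stays
  bounded, hence it is nonincreasing and its initial slope \<open>\<nabla>\<phi>(d 0) \<bullet> d' 0\<close> is not positive. The
  tangent inequality at \<open>d 0\<close> in the direction \<open>- d' 0\<close>, which up to a positive factor is the
  difference of the Neumann data, is then \<open>\<phi> (d 0) \<le> \<phi> (d 0 - \<mu> d' 0)\<close>, the claim.

  As \<open>\<phi>\<close> is only lower semicontinuous and may be infinite, the argument is run for its Moreau
  envelopes, which are finite, convex, have a Lipschitz gradient \<open>G\<close> and are bounded on bounded sets.
  Two facts make this possible: the envelope inherits the contraction property of the resolvents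
  of \<open>A\<close> (\<open>envelope_contraction\<close>; it is here that the resolvents must be defined everywhere,
  \<open>maximal_monotone_Range_id_plus\<close>), and an inequality that holds for all envelopes holds for \<open>\<phi>\<close>
  (\<open>sublevel_of_moreau_envelopes\<close>).

  The envelope is only once differentiable and \<open>d''\<close> exists only in the weak sense, so convexity of
  the envelope along \<open>d\<close> is proved as monotonicity of the slope \<open>G(d) \<bullet> d'\<close> (\<open>slope_mono\<close>). What it
  needs from the weak formulation is scalar: for each fixed \<open>g\<close>, the increment of \<open>g \<bullet> d'\<close> is the
  Lebesgue integral of \<open>g \<bullet> d''\<close> (\<open>W22_loc_integral_second_derivative\<close>). That identity follows by
  testing with differences of steep smooth steps.
\<close>

section \<open>Resolvents of maximal monotone operators\<close>

lemma monotone_op_dist_le: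
  fixes A :: "('h::real_inner \<times> 'h) set"
  assumes "monotone_op A" "(u, w) \<in> A" "(u', w') \<in> A" "\<mu> \<ge> 0"
  shows "norm (u - u') \<le> norm ((u + \<mu> *\<^sub>R w) - (u' + \<mu> *\<^sub>R w'))"
proof -
  have mon: "inner (w - w') (u - u') \<ge> 0"
    using assms(1-3) unfolding monotone_op_def by fastforce
  have "(norm (u - u'))\<^sup>2 \<le> inner ((u + \<mu> *\<^sub>R w) - (u' + \<mu> *\<^sub>R w')) (u - u')"
  proof -
    have "inner ((u + \<mu> *\<^sub>R w) - (u' + \<mu> *\<^sub>R w')) (u - u')
        = inner (u - u') (u - u') + \<mu> * inner (w - w') (u - u')"
      by (simp add: algebra_simps)
    with mon assms(4) show ?thesis by (simp add: power2_norm_eq_inner)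
  qed
  also have "\<dots> \<le> norm ((u + \<mu> *\<^sub>R w) - (u' + \<mu> *\<^sub>R w')) * norm (u - u')"
    by (rule norm_cauchy_schwarz)
  finally show ?thesis
    by (metis mult_right_le_imp_le norm_ge_zero order_le_less power2_eq_square)
qed

lemma Range_id_plus_eq_UNIV_iff:
  "Range (id_plus \<mu> B) = UNIV \<longleftrightarrow> (\<forall>x. \<exists>u w. (u, w) \<in> B \<and> u + \<mu> *\<^sub>R w = x)"
  unfolding id_plus_def by (auto simp: Range_iff set_eq_iff) (metis+)

text \<open>The inclusion \<open>x \<in> u + \<mu> A u\<close> is the fixed point equation of
  \<open>u \<mapsto> J\<^sub>\<kappa> ((\<kappa>/\<mu>) x + (1 - \<kappa>/\<mu>) u)\<close>. As \<open>J\<^sub>\<kappa>\<close> does not expand distances, this map has the Lipschitz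
  constant \<open>\<bar>1 - \<kappa>/\<mu>\<bar>\<close>, which is smaller than \<open>1\<close> exactly when \<open>\<kappa> < 2 \<mu>\<close>.\<close>

lemma Range_id_plus_step:
  fixes A :: "('h::{real_inner, complete_space} \<times> 'h) set"
  assumes mon: "monotone_op A" and full: "Range (id_plus \<kappa> A) = UNIV"
    and \<kappa>: "\<kappa> > 0" and \<mu>: "\<kappa> < 2 * \<mu>"
  shows "Range (id_plus \<mu> A) = UNIV"
  unfolding Range_id_plus_eq_UNIV_iff
proof
  fix x :: 'h
  obtain J W where J: "\<And>x. (J x, W x) \<in> A" "\<And>x. J x + \<kappa> *\<^sub>R W x = x"
    using full unfolding Range_id_plus_eq_UNIV_iff by metis
  define \<theta> where "\<theta> = \<kappa> / \<mu>"
  define T where "T = (\<lambda>u. J (\<theta> *\<^sub>R x + (1 - \<theta>) *\<^sub>R u))"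
  have \<theta>: "0 < \<theta>" "\<theta> < 2" using \<kappa> \<mu> by (auto simp: \<theta>_def field_simps)
  have nonexp: "dist (J y) (J z) \<le> dist y z" for y z
    using monotone_op_dist_le[OF mon J(1)[of y] J(1)[of z], of \<kappa>] \<kappa> by (simp add: dist_norm J(2))
  have contr: "dist (T u) (T u') \<le> \<bar>1 - \<theta>\<bar> * dist u u'" for u u'
  proof -
    have "dist (T u) (T u') \<le> norm ((1 - \<theta>) *\<^sub>R (u - u'))"
      using nonexp[of "\<theta> *\<^sub>R x + (1 - \<theta>) *\<^sub>R u" "\<theta> *\<^sub>R x + (1 - \<theta>) *\<^sub>R u'"]
      unfolding T_def by (simp add: dist_norm algebra_simps)
    then show ?thesis by (simp add: dist_norm)
  qed
  have "\<exists>!u. T u = u"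
    by (rule banach_fix_type[where c = "\<bar>1 - \<theta>\<bar>"])
      (use \<theta> contr in auto)
  then obtain u where u: "T u = u" by auto
  define w where "w = W (\<theta> *\<^sub>R x + (1 - \<theta>) *\<^sub>R u)"
  have "u + \<kappa> *\<^sub>R w = \<theta> *\<^sub>R x + (1 - \<theta>) *\<^sub>R u"
    using J(2) u unfolding T_def w_def by metis
  then have "\<kappa> *\<^sub>R w = \<theta> *\<^sub>R (x - u)" by (simp add: algebra_simps)
  then have "\<mu> *\<^sub>R (\<kappa> *\<^sub>R w) = \<mu> *\<^sub>R (\<theta> *\<^sub>R (x - u))" by (rule arg_cong)
  then have "\<kappa> *\<^sub>R (\<mu> *\<^sub>R w) = \<kappa> *\<^sub>R (x - u)" using \<mu> \<kappa> by (simp add: \<theta>_def mult.commute)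
  then have "\<mu> *\<^sub>R w = x - u" using \<kappa> scaleR_left_imp_eq[of \<kappa>] by blast
  moreover have "(u, w) \<in> A" using J(1) u unfolding T_def w_def by metis
  ultimately show "\<exists>u w. (u, w) \<in> A \<and> u + \<mu> *\<^sub>R w = x"
    by (intro exI[of _ u] exI[of _ w]) auto
qed

text \<open>Surjectivity passes from one parameter to every parameter above half of it, so that descending by
  the factor \<open>2/3\<close> finitely often reaches any positive number.\<close>

lemma maximal_monotone_Range_id_plus:
  fixes A :: "('h::{real_inner, complete_space} \<times> 'h) set"
  assumes "maximal_monotone_op A" and \<mu>: "\<mu> > 0"
  shows "Range (id_plus \<mu> A) = UNIV"
proof -
  have mon: "monotone_op A" and one: "Range (id_plus 1 A) = UNIV"
    using assms(1) unfolding maximal_monotone_op_def by auto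
  have pow: "Range (id_plus ((2/3)^n) A) = UNIV" for n
  proof (induction n)
    case (Suc n)
    then show ?case by (rule Range_id_plus_step[OF mon]) auto
  qed (simp add: one)
  obtain n where "(2/3::real)^n < 2 * \<mu>"
    using real_arch_pow_inv[of "2 * \<mu>" "2/3"] \<mu> by auto
  then show ?thesis by (intro Range_id_plus_step[OF mon pow]) auto
qed

section \<open>Moreau envelopes of closed convex functions\<close>

text \<open>An extended-valued function that is convex, proper and lower semicontinuous is represented by its
  effective domain \<open>D\<close> and its real values there; lower semicontinuity of the extension by infinity
  means that the sublevel sets within \<open>D\<close> are closed in the whole space.\<close>

locale closed_convex_function =
  fixes D :: "'h::{real_inner, complete_space} set" and f :: "'h \<Rightarrow> real"
  assumes nonempty: "D \<noteq> {}"
    and conv: "convex_on D f"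
    and closed_sublevel: "\<And>c. closed {x \<in> D. f x \<le> c}"
begin

lemma convex_combination_in:
  "x \<in> D \<Longrightarrow> y \<in> D \<Longrightarrow> 0 \<le> t \<Longrightarrow> t \<le> 1 \<Longrightarrow> (1 - t) *\<^sub>R x + t *\<^sub>R y \<in> D"
  using convex_on_imp_convex[OF conv] by (auto simp: convex_alt)

text \<open>Closedness of a sublevel set bounds \<open>f\<close> from below on a ball around some \<open>x0 \<in> D\<close>; convexity along
  the segment from \<open>x0\<close> to a distant point \<open>y\<close>, which meets the ball, turns this into a bound that
  decreases at most linearly.\<close>

lemma affine_lower_bound:
  obtains b a where "b \<ge> 0" "\<And>y. y \<in> D \<Longrightarrow> f y \<ge> a - b * norm y"
proof -
  obtain x0 where x0: "x0 \<in> D" using nonempty by auto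
  have "open (- {x \<in> D. f x \<le> f x0 - 1})" using closed_sublevel by (simp add: open_Compl)
  moreover have "x0 \<in> - {x \<in> D. f x \<le> f x0 - 1}" by auto
  ultimately obtain r where r: "r > 0" "ball x0 r \<subseteq> - {x \<in> D. f x \<le> f x0 - 1}"
    using open_contains_ball by metis
  have near: "f y > f x0 - 1" if "y \<in> D" "norm (y - x0) < r" for y
    using r(2) that by (auto simp: ball_def dist_norm norm_minus_commute subset_iff)
  have bd: "f y \<ge> f x0 - 1 - 2 / r * norm (y - x0)" if y: "y \<in> D" for y
  proof (cases "norm (y - x0) < r")
    case True
    have "2 / r * norm (y - x0) \<ge> 0" using r by simp
    then show ?thesis using near[OF y True] by linarith
  next
    case False
    \<comment> \<open>The point \<open>(1 - t) x0 + t y\<close> lies at distance \<open>r / 2\<close> from \<open>x0\<close>.\<close>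
    define t where "t = r / (2 * norm (y - x0))"
    have pos: "norm (y - x0) > 0" using False r by linarith
    have t: "0 < t" "t < 1" using False r pos by (auto simp: t_def field_simps)
    have eq: "(1 - t) *\<^sub>R x0 + t *\<^sub>R y - x0 = t *\<^sub>R (y - x0)" by (simp add: algebra_simps)
    have "norm (t *\<^sub>R (y - x0)) = r / 2" using r pos by (simp add: t_def)
    then have "norm ((1 - t) *\<^sub>R x0 + t *\<^sub>R y - x0) < r" unfolding eq using r by simp
    moreover have "(1 - t) *\<^sub>R x0 + t *\<^sub>R y \<in> D"
      by (rule convex_combination_in) (use x0 y t in auto)
    ultimately have "f x0 - 1 < f ((1 - t) *\<^sub>R x0 + t *\<^sub>R y)" by (intro near)
    also have "\<dots> \<le> (1 - t) * f x0 + t * f y"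
      by (rule convex_onD[OF conv]) (use x0 y t in auto)
    finally have "t * (f x0 - f y) < 1" by (simp add: algebra_simps)
    then have "f x0 - f y < 1 / t" using t by (simp add: field_simps)
    also have "1 / t = 2 / r * norm (y - x0)" using r by (simp add: t_def)
    finally show ?thesis by linarith
  qed
  show ?thesis
  proof
    show "2 / r \<ge> 0" using r by simp
    fix y assume y: "y \<in> D"
    have "2 / r * norm (y - x0) \<le> 2 / r * (norm y + norm x0)"
      using r by (intro mult_left_mono norm_triangle_ineq4) auto
    with bd[OF y] show "f y \<ge> (f x0 - 1 - 2 / r * norm x0) - 2 / r * norm y"
      unfolding distrib_left by linarith
  qed
qed

text \<open>The quadratic term makes the functional strongly convex: by the parallelogram law two points with
  almost minimal values are close (\<open>gap\<close>), so a minimizing sequence is a Cauchy sequence.\<close>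

lemma prox_exists:
  assumes \<epsilon>: "\<epsilon> > 0"
  obtains p where "p \<in> D" "\<And>y. y \<in> D \<Longrightarrow>
    f p + (norm (x - p))\<^sup>2 / (2 * \<epsilon>) \<le> f y + (norm (x - y))\<^sup>2 / (2 * \<epsilon>)"
proof -
  define h where "h y = f y + (norm (x - y))\<^sup>2 / (2 * \<epsilon>)" for y
  obtain a b where ab: "b \<ge> 0" "\<And>y. y \<in> D \<Longrightarrow> f y \<ge> a - b * norm y"
    by (rule affine_lower_bound, rule that)
  have h_lower: "h y \<ge> a - b * norm x - b\<^sup>2 * \<epsilon> / 2" if y: "y \<in> D" for y
  proof -
    define t where "t = norm (x - y)"
    have "norm y \<le> norm x + t" 
      unfolding t_def using norm_triangle_sub[of y x] by (simp add: norm_minus_commute)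
    then have "b * norm y \<le> b * norm x + b * t" using ab(1) by (metis distrib_left mult_left_mono)
    moreover have "t\<^sup>2 / (2 * \<epsilon>) - b * t + b\<^sup>2 * \<epsilon> / 2 = (t - b * \<epsilon>)\<^sup>2 / (2 * \<epsilon>)"
      using \<epsilon> by (simp add: power2_eq_square field_simps)
    moreover have "(t - b * \<epsilon>)\<^sup>2 / (2 * \<epsilon>) \<ge> 0" using \<epsilon> by simp
    ultimately show ?thesis using ab(2)[OF y] unfolding h_def t_def by linarith
  qed
  define m where "m = Inf (h ` D)"
  have bdd: "bdd_below (h ` D)" using h_lower by (auto intro!: bdd_belowI2)
  have m_le: "m \<le> h y" if "y \<in> D" for y unfolding m_def using bdd that by (auto intro: cInf_lower)
  have "\<exists>y\<in>D. h y < m + 1 / real (Suc n)" for n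
    using cInf_less_iff[of "h ` D" "m + 1 / real (Suc n)"] bdd nonempty by (auto simp: m_def)
  then obtain Y where Y: "\<And>n. Y n \<in> D" "\<And>n. h (Y n) < m + 1 / real (Suc n)" by metis
  have gap: "(norm (y - z))\<^sup>2 \<le> 4 * \<epsilon> * (h y + h z - 2 * m)" if y: "y \<in> D" and z: "z \<in> D" for y z
  proof -
    define c where "c = (1 - 1/2) *\<^sub>R y + (1/2::real) *\<^sub>R z"
    have c: "c \<in> D"
      unfolding c_def by (rule convex_combination_in) (use y z in auto)
    have fc: "f c \<le> (1 - 1/2) * f y + 1/2 * f z"
      unfolding c_def by (rule convex_onD[OF conv]) (use y z in auto)
    have "(x - y) + (x - z) = 2 *\<^sub>R (x - c)" by (simp add: c_def algebra_simps scaleR_2)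
    then have "(norm (x - c))\<^sup>2 = (norm ((x - y) + (x - z)))\<^sup>2 / 4"
      by (simp add: power_mult_distrib)
    moreover have "(norm ((x - y) + (x - z)))\<^sup>2 + (norm (z - y))\<^sup>2
        = 2 * (norm (x - y))\<^sup>2 + 2 * (norm (x - z))\<^sup>2"
      by (simp add: power2_norm_eq_inner inner_simps algebra_simps inner_commute)
    ultimately have nc: "(norm (x - c))\<^sup>2 = (2 * (norm (x - y))\<^sup>2 + 2 * (norm (x - z))\<^sup>2 - (norm (y - z))\<^sup>2) / 4"
      by (simp add: norm_minus_commute)
    have "2 * m \<le> 2 * h c" using m_le[OF c] by simp
    also have "\<dots> \<le> h y + h z - (norm (y - z))\<^sup>2 / (4 * \<epsilon>)"
    proof -
      have "2 * ((2 * u + 2 * v - w) / 4 / (2 * \<epsilon>)) = u / (2 * \<epsilon>) + v / (2 * \<epsilon>) - w / (4 * \<epsilon>)" for u v w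
        using \<epsilon> by (simp add: field_simps)
      then show ?thesis using fc unfolding h_def nc distrib_left by simp
    qed
    finally show ?thesis using \<epsilon> by (simp add: field_simps)
  qed
  have "Cauchy Y"
  proof (rule metric_CauchyI)
    fix e :: real assume e: "e > 0"
    obtain N where N: "1 / real (Suc N) < e\<^sup>2 / (8 * \<epsilon>)"
      using e \<epsilon> nat_approx_posE[of "e\<^sup>2 / (8 * \<epsilon>)"] by auto
    show "\<exists>M. \<forall>m\<ge>M. \<forall>n\<ge>M. dist (Y m) (Y n) < e"
    proof (intro exI allI impI)
      fix i j assume ij: "N \<le> i" "N \<le> j"
      have "1 / real (Suc i) \<le> 1 / real (Suc N)" "1 / real (Suc j) \<le> 1 / real (Suc N)"
        using ij by (auto intro!: divide_left_mono)
      then have "h (Y i) + h (Y j) - 2 * m < 2 * (e\<^sup>2 / (8 * \<epsilon>))"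
        using Y(2)[of i] Y(2)[of j] N by linarith
      then have "4 * \<epsilon> * (h (Y i) + h (Y j) - 2 * m) < 4 * \<epsilon> * (2 * (e\<^sup>2 / (8 * \<epsilon>)))"
        using \<epsilon> by (intro mult_strict_left_mono) auto
      also have "\<dots> = e\<^sup>2" using \<epsilon> by simp
      finally have "(norm (Y i - Y j))\<^sup>2 < e\<^sup>2" using gap[OF Y(1) Y(1), of i j] by linarith
      then show "dist (Y i) (Y j) < e" using e by (simp add: dist_norm power_less_imp_less_base)
    qed
  qed
  then obtain p where p: "Y \<longlonglongrightarrow> p" using Cauchy_convergent_iff convergent_def by blast
  define r where "r = m - (norm (x - p))\<^sup>2 / (2 * \<epsilon>)"
  have "(\<lambda>n. m + 1 / real (Suc n) - (norm (x - Y n))\<^sup>2 / (2 * \<epsilon>)) \<longlonglongrightarrow> m + 0 - (norm (x - p))\<^sup>2 / (2 * \<epsilon>)"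
    by (intro tendsto_intros p LIMSEQ_Suc[OF lim_1_over_n]) (use \<epsilon> in auto)
  then have lim: "(\<lambda>n. m + 1 / real (Suc n) - (norm (x - Y n))\<^sup>2 / (2 * \<epsilon>)) \<longlonglongrightarrow> r" by (simp add: r_def)
  have sub: "p \<in> {y \<in> D. f y \<le> c}" if "r < c" for c
  proof (rule Lim_in_closed_set[OF closed_sublevel _ _ p])
    show "\<forall>\<^sub>F n in sequentially. Y n \<in> {y \<in> D. f y \<le> c}"
      using order_tendstoD(2)[OF lim that]
    proof eventually_elim
      case (elim n)
      then show ?case using Y(1)[of n] Y(2)[of n] unfolding h_def by auto
    qed
  qed auto
  have "f p \<le> r" using sub by (auto intro: dense_ge)
  show ?thesis
  proof
    show "p \<in> D" using sub[of "r + 1"] by auto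
    fix y assume "y \<in> D"
    from m_le[OF this] \<open>f p \<le> r\<close>
    show "f p + (norm (x - p))\<^sup>2 / (2 * \<epsilon>) \<le> f y + (norm (x - y))\<^sup>2 / (2 * \<epsilon>)"
      unfolding r_def h_def by linarith
  qed
qed

definition prox :: "real \<Rightarrow> 'h \<Rightarrow> 'h" where
  "prox \<epsilon> x = (SOME p. p \<in> D \<and>
    (\<forall>y\<in>D. f p + (norm (x - p))\<^sup>2 / (2 * \<epsilon>) \<le> f y + (norm (x - y))\<^sup>2 / (2 * \<epsilon>)))"

text \<open>The infimum over \<open>y\<close> of \<open>f y + \<parallel>x - y\<parallel>\<^sup>2 / (2\<epsilon>)\<close>, expressed by its minimizer.\<close>

definition moreau_envelope :: "real \<Rightarrow> 'h \<Rightarrow> real" where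
  "moreau_envelope \<epsilon> x = f (prox \<epsilon> x) + (norm (x - prox \<epsilon> x))\<^sup>2 / (2 * \<epsilon>)"

text \<open>The Yosida approximation of the subdifferential of \<open>f\<close>.\<close>

definition envelope_gradient :: "real \<Rightarrow> 'h \<Rightarrow> 'h" where
  "envelope_gradient \<epsilon> x = (1 / \<epsilon>) *\<^sub>R (x - prox \<epsilon> x)"

context
  fixes \<epsilon> :: real
  assumes \<epsilon>: "\<epsilon> > 0"
begin

lemma prox_in: "prox \<epsilon> x \<in> D"
  and moreau_envelope_le: "y \<in> D \<Longrightarrow> moreau_envelope \<epsilon> x \<le> f y + (norm (x - y))\<^sup>2 / (2 * \<epsilon>)"
proof -
  have "prox \<epsilon> x \<in> D \<and> (\<forall>y\<in>D. f (prox \<epsilon> x) + (norm (x - prox \<epsilon> x))\<^sup>2 / (2 * \<epsilon>)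
      \<le> f y + (norm (x - y))\<^sup>2 / (2 * \<epsilon>))"
    unfolding prox_def by (rule someI_ex) (metis prox_exists[OF \<epsilon>])
  then show "prox \<epsilon> x \<in> D"
    and "y \<in> D \<Longrightarrow> moreau_envelope \<epsilon> x \<le> f y + (norm (x - y))\<^sup>2 / (2 * \<epsilon>)"
    unfolding moreau_envelope_def by auto
qed

text \<open>The Euler inequality of the minimization problem: compare the minimizer with the points
  \<open>(1 - t) p + t y\<close> and let \<open>t\<close> tend to \<open>0\<close>.\<close>

lemma prox_subgradient:
  assumes y: "y \<in> D"
  shows "f y \<ge> f (prox \<epsilon> x) + inner (envelope_gradient \<epsilon> x) (y - prox \<epsilon> x)"
proof -
  define p where "p = prox \<epsilon> x"
  define C where "C = (norm (y - p))\<^sup>2 / (2 * \<epsilon>)"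
  define G where "G = inner (envelope_gradient \<epsilon> x) (y - p)"
  have G: "G = inner (x - p) (y - p) / \<epsilon>" by (simp add: G_def envelope_gradient_def p_def)
  have p: "p \<in> D" unfolding p_def by (rule prox_in)
  have "G - t * C \<le> f y - f p" if t: "0 < t" "t < 1" for t
  proof -
    define q where "q = (1 - t) *\<^sub>R p + t *\<^sub>R y"
    have q: "q \<in> D"
      unfolding q_def by (rule convex_combination_in) (use p y t in auto)
    have fq: "f q \<le> (1 - t) * f p + t * f y"
      unfolding q_def by (rule convex_onD[OF conv]) (use p y t in auto)
    have "x - q = (x - p) - t *\<^sub>R (y - p)" by (simp add: q_def algebra_simps)
    moreover have "(norm (v - t *\<^sub>R w))\<^sup>2 = (norm v)\<^sup>2 - 2 * t * inner v w + t\<^sup>2 * (norm w)\<^sup>2" for v w :: 'h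
      unfolding power2_norm_eq_inner by (simp add: inner_diff inner_commute power2_eq_square algebra_simps)
    ultimately have "(norm (x - q))\<^sup>2
        = (norm (x - p))\<^sup>2 - 2 * t * inner (x - p) (y - p) + t\<^sup>2 * (norm (y - p))\<^sup>2"
      by metis
    then have nq: "(norm (x - q))\<^sup>2 / (2 * \<epsilon>) = (norm (x - p))\<^sup>2 / (2 * \<epsilon>) - t * G + t * (t * C)"
      using \<epsilon> by (simp add: G C_def field_simps power2_eq_square)
    have "f p + (norm (x - p))\<^sup>2 / (2 * \<epsilon>) \<le> f q + (norm (x - q))\<^sup>2 / (2 * \<epsilon>)"
      using moreau_envelope_le[OF q, of x] unfolding moreau_envelope_def p_def .
    with fq nq have "t * (G - t * C) \<le> t * (f y - f p)" by (simp add: algebra_simps)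
    then show ?thesis using t by simp
  qed
  then have "\<forall>\<^sub>F t in at_right 0. G - t * C \<le> f y - f p"
    unfolding eventually_at_right_field by (intro exI[of _ 1]) auto
  moreover have "((\<lambda>t. G - t * C) \<longlongrightarrow> G - 0 * C) (at_right 0)" by (intro tendsto_intros)
  ultimately have "G - 0 * C \<le> f y - f p"
    using tendsto_upperbound[of "\<lambda>t. G - t * C" "G - 0 * C" "at_right 0"] by simp
  then show ?thesis unfolding G_def p_def by linarith
qed

text \<open>The term beyond the tangent inequality comes from the quadratic parts of the two envelope values;
  adding the inequality to the one with \<open>x\<close> and \<open>y\<close> exchanged yields at once monotonicity and
  Lipschitz continuity of the gradient.\<close>

lemma moreau_envelope_gradient_gap:
  "moreau_envelope \<epsilon> y - moreau_envelope \<epsilon> x \<ge>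
    inner (envelope_gradient \<epsilon> x) (y - x)
    + \<epsilon> / 2 * (norm (envelope_gradient \<epsilon> y - envelope_gradient \<epsilon> x))\<^sup>2"
proof -
  let ?G = "envelope_gradient \<epsilon>"
  have pG: "prox \<epsilon> z = z - \<epsilon> *\<^sub>R ?G z" for z using \<epsilon> by (simp add: envelope_gradient_def)
  have env: "moreau_envelope \<epsilon> z = f (prox \<epsilon> z) + \<epsilon> / 2 * inner (?G z) (?G z)" for z
  proof -
    have "z - prox \<epsilon> z = \<epsilon> *\<^sub>R ?G z" by (simp add: pG)
    then have "moreau_envelope \<epsilon> z = f (prox \<epsilon> z) + (norm (\<epsilon> *\<^sub>R ?G z))\<^sup>2 / (2 * \<epsilon>)"
      unfolding moreau_envelope_def by simp
    also have "(norm (\<epsilon> *\<^sub>R ?G z))\<^sup>2 / (2 * \<epsilon>) = \<epsilon> / 2 * (norm (?G z))\<^sup>2"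
      using \<epsilon> by (simp add: power2_eq_square)
    finally show ?thesis by (simp add: power2_norm_eq_inner)
  qed
  have "f (prox \<epsilon> y) - f (prox \<epsilon> x) \<ge> inner (?G x) (prox \<epsilon> y - prox \<epsilon> x)"
    using prox_subgradient[OF prox_in, of x y] by simp
  moreover have "prox \<epsilon> y - prox \<epsilon> x = (y - x) - \<epsilon> *\<^sub>R (?G y - ?G x)"
    unfolding pG by (simp add: algebra_simps)
  ultimately show ?thesis unfolding env
    by (simp add: power2_norm_eq_inner inner_diff inner_commute algebra_simps)
qed

lemma moreau_envelope_ge_tangent:
  "moreau_envelope \<epsilon> y \<ge> moreau_envelope \<epsilon> x + inner (envelope_gradient \<epsilon> x) (y - x)"
proof -
  have "\<epsilon> / 2 * (norm (envelope_gradient \<epsilon> y - envelope_gradient \<epsilon> x))\<^sup>2 \<ge> 0" using \<epsilon> by simp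
  with moreau_envelope_gradient_gap[of x y] show ?thesis by linarith
qed

lemma envelope_gradient_cocoercive:
  "inner (envelope_gradient \<epsilon> y - envelope_gradient \<epsilon> x) (y - x)
    \<ge> \<epsilon> * (norm (envelope_gradient \<epsilon> y - envelope_gradient \<epsilon> x))\<^sup>2"
  using moreau_envelope_gradient_gap[of x y] moreau_envelope_gradient_gap[of y x]
  by (simp add: inner_diff algebra_simps norm_minus_commute)

lemma envelope_gradient_monotone:
  "inner (envelope_gradient \<epsilon> y - envelope_gradient \<epsilon> x) (y - x) \<ge> 0"
proof -
  have "\<epsilon> * (norm (envelope_gradient \<epsilon> y - envelope_gradient \<epsilon> x))\<^sup>2 \<ge> 0" using \<epsilon> by simp
  with envelope_gradient_cocoercive[of y x] show ?thesis by linarith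
qed

lemma envelope_gradient_lipschitz:
  "norm (envelope_gradient \<epsilon> y - envelope_gradient \<epsilon> x) \<le> norm (y - x) / \<epsilon>"
proof -
  let ?g = "norm (envelope_gradient \<epsilon> y - envelope_gradient \<epsilon> x)"
  have "?g * (\<epsilon> * ?g) \<le> ?g * norm (y - x)"
    using envelope_gradient_cocoercive[of y x]
      norm_cauchy_schwarz[of "envelope_gradient \<epsilon> y - envelope_gradient \<epsilon> x" "y - x"]
    by (simp add: power2_eq_square mult.left_commute)
  then have "\<epsilon> * ?g \<le> norm (y - x)"
    by (cases "?g = 0") (auto simp del: right_minus_eq)
  then show ?thesis using \<epsilon> by (simp add: field_simps)
qed

lemma isCont_envelope_gradient: "isCont (envelope_gradient \<epsilon>) x"
proof -
  have "((\<lambda>y. envelope_gradient \<epsilon> y - envelope_gradient \<epsilon> x) \<longlongrightarrow> 0) (at x)"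
  proof (rule Lim_null_comparison)
    show "\<forall>\<^sub>F y in at x. norm (envelope_gradient \<epsilon> y - envelope_gradient \<epsilon> x) \<le> norm (y - x) / \<epsilon>"
      using envelope_gradient_lipschitz by simp
    have "((\<lambda>y. norm (y - x) / \<epsilon>) \<longlongrightarrow> norm (x - x) / \<epsilon>) (at x)"
      by (intro tendsto_intros) (use \<epsilon> in auto)
    then show "((\<lambda>y. norm (y - x) / \<epsilon>) \<longlongrightarrow> 0) (at x)" by simp
  qed
  then show ?thesis unfolding isCont_def by (simp add: LIM_zero_iff)
qed

text \<open>The tangent inequalities at \<open>x\<close> and at \<open>y\<close> enclose the remainder between \<open>0\<close> and
  \<open>(G y - G x) \<bullet> (y - x)\<close>, where \<open>G\<close> is the gradient, and the latter is quadratic in \<open>y - x\<close> because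
  \<open>G\<close> is Lipschitz.\<close>

lemma moreau_envelope_has_derivative:
  "(moreau_envelope \<epsilon> has_derivative (\<lambda>h. inner (envelope_gradient \<epsilon> x) h)) (at x)"
  unfolding has_derivative_iff_norm
proof
  show "bounded_linear (\<lambda>h. inner (envelope_gradient \<epsilon> x) h)" by (rule bounded_linear_inner_right)
  have bd: "norm (moreau_envelope \<epsilon> y - moreau_envelope \<epsilon> x - inner (envelope_gradient \<epsilon> x) (y - x)) / norm (y - x)
      \<le> norm (y - x) / \<epsilon>" for y
  proof -
    let ?R = "moreau_envelope \<epsilon> y - moreau_envelope \<epsilon> x - inner (envelope_gradient \<epsilon> x) (y - x)"
    have "0 \<le> ?R" using moreau_envelope_ge_tangent[of x y] by simp
    moreover have "?R \<le> inner (envelope_gradient \<epsilon> y - envelope_gradient \<epsilon> x) (y - x)"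
      using moreau_envelope_ge_tangent[of y x] by (simp add: inner_diff algebra_simps)
    moreover have "\<dots> \<le> norm (envelope_gradient \<epsilon> y - envelope_gradient \<epsilon> x) * norm (y - x)"
      by (rule norm_cauchy_schwarz)
    moreover have "\<dots> \<le> norm (y - x) / \<epsilon> * norm (y - x)"
      by (intro mult_right_mono envelope_gradient_lipschitz) auto
    ultimately have "norm ?R \<le> norm (y - x) / \<epsilon> * norm (y - x)" by simp
    then show ?thesis by (cases "y = x") (auto simp: divide_le_eq)
  qed
  have "((\<lambda>y. norm (y - x) / \<epsilon>) \<longlongrightarrow> norm (x - x) / \<epsilon>) (at x)"
    by (intro tendsto_intros) (use \<epsilon> in auto)
  then have lim: "((\<lambda>y. norm (y - x) / \<epsilon>) \<longlongrightarrow> 0) (at x)" by simp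
  show "((\<lambda>y. norm (moreau_envelope \<epsilon> y - moreau_envelope \<epsilon> x - inner (envelope_gradient \<epsilon> x) (y - x)) / norm (y - x)) \<longlongrightarrow> 0) (at x)"
    by (rule Lim_null_comparison[OF _ lim]) (use bd in auto)
qed

end

text \<open>The bound keeps the proximal points of \<open>x\<close> in the sublevel set of \<open>M\<close>. Against the affine lower bound
  the quadratic term forces them to converge to \<open>x\<close> as \<open>\<epsilon>\<close> tends to \<open>0\<close>, and the sublevel set is
  closed.\<close>

lemma sublevel_of_moreau_envelopes:
  assumes le: "\<And>\<epsilon>. \<epsilon> > 0 \<Longrightarrow> moreau_envelope \<epsilon> x \<le> M"
  shows "x \<in> D \<and> f x \<le> M"
proof (rule ccontr)
  assume "\<not> (x \<in> D \<and> f x \<le> M)"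
  then have "x \<in> - {y \<in> D. f y \<le> M}" by auto
  moreover have "open (- {y \<in> D. f y \<le> M})" using closed_sublevel by (simp add: open_Compl)
  ultimately obtain r where r: "r > 0" "ball x r \<subseteq> - {y \<in> D. f y \<le> M}"
    using open_contains_ball by metis
  obtain a b where ab: "b \<ge> 0" "\<And>y. y \<in> D \<Longrightarrow> f y \<ge> a - b * norm y"
    by (rule affine_lower_bound, rule that)
  \<comment> \<open>Chosen so that \<open>r \<le> t \<Longrightarrow> (M - a + b \<parallel>x\<parallel>) + b t < C t\<close>; with this \<open>\<epsilon>\<close> the distance \<open>t\<close> from \<open>x\<close>
    to its proximal point would be less than \<open>r\<close>.\<close>
  define C where "C = \<bar>M - a + b * norm x\<bar> / r + b + 1"
  have C: "C > 0" using r ab by (auto simp: C_def intro!: add_nonneg_pos add_nonneg_nonneg)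
  define \<epsilon> where "\<epsilon> = r / (2 * C)"
  have \<epsilon>: "\<epsilon> > 0" using r C by (simp add: \<epsilon>_def)
  define p where "p = prox \<epsilon> x"
  define t where "t = norm (x - p)"
  have p: "p \<in> D" using prox_in[OF \<epsilon>] unfolding p_def .
  have E: "f p + t\<^sup>2 / (2 * \<epsilon>) \<le> M" using le[OF \<epsilon>] unfolding moreau_envelope_def t_def p_def .
  moreover have "t\<^sup>2 / (2 * \<epsilon>) \<ge> 0" using \<epsilon> by simp
  ultimately have "p \<in> {y \<in> D. f y \<le> M}" using p by auto
  then have tr: "t \<ge> r" using r(2) by (auto simp: t_def ball_def dist_norm subset_iff not_less)
  have "norm p \<le> norm x + t" 
      unfolding t_def using norm_triangle_sub[of p x] by (simp add: norm_minus_commute)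
  then have "b * norm p \<le> b * norm x + b * t" using ab(1) by (metis distrib_left mult_left_mono)
  then have "t\<^sup>2 / (2 * \<epsilon>) \<le> (M - a + b * norm x) + b * t" using E ab(2)[OF p] by linarith
  also have "\<dots> \<le> \<bar>M - a + b * norm x\<bar> / r * t + b * t"
  proof -
    have "\<bar>M - a + b * norm x\<bar> / r * r \<le> \<bar>M - a + b * norm x\<bar> / r * t"
      using tr r by (intro mult_left_mono) auto
    then show ?thesis using r by auto
  qed
  also have "\<dots> < C * t" using tr r by (simp add: C_def algebra_simps)
  finally have "t * t < t * (2 * \<epsilon> * C)" using \<epsilon> by (simp add: field_simps power2_eq_square)
  then have "t < 2 * \<epsilon> * C" using tr r by simp
  also have "\<dots> = r" using C by (simp add: \<epsilon>_def)
  finally show False using tr by simp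
qed
end

section \<open>Envelopes, resolvents and extended-valued functionals\<close>

text \<open>Write \<open>x, x'\<close> for the arguments of the resolvent \<open>J\<close>, so \<open>J x = u\<close> and \<open>J x' = u'\<close>, and let \<open>p\<close>
  be the proximal point of \<open>x - x'\<close>. The competitor for the envelope at \<open>u - u'\<close> is \<open>J (x' + p) - u'\<close>:
  its value under \<open>f\<close> is at most \<open>f p\<close> by hypothesis, and its distance from \<open>u - u'\<close> is at most
  \<open>\<parallel>x - x' - p\<parallel>\<close> because \<open>J\<close> does not expand distances. Surjectivity is used to define \<open>J\<close> at \<open>x' + p\<close>.\<close>

lemma (in closed_convex_function) envelope_contraction:
  assumes mon: "monotone_op A" and full: "Range (id_plus \<mu> A) = UNIV" and \<mu>: "\<mu> \<ge> 0"
    and contr: "\<And>u w u' w'. (u, w) \<in> A \<Longrightarrow> (u', w') \<in> A \<Longrightarrow>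
      (u + \<mu> *\<^sub>R w) - (u' + \<mu> *\<^sub>R w') \<in> D \<Longrightarrow>
      u - u' \<in> D \<and> f (u - u') \<le> f ((u + \<mu> *\<^sub>R w) - (u' + \<mu> *\<^sub>R w'))"
    and A: "(u, w) \<in> A" "(u', w') \<in> A" and \<epsilon>: "\<epsilon> > 0"
  shows "moreau_envelope \<epsilon> (u - u') \<le> moreau_envelope \<epsilon> ((u + \<mu> *\<^sub>R w) - (u' + \<mu> *\<^sub>R w'))"
proof -
  define x where "x = u + \<mu> *\<^sub>R w"
  define x' where "x' = u' + \<mu> *\<^sub>R w'"
  define p where "p = prox \<epsilon> (x - x')"
  obtain z r where z: "(z, r) \<in> A" "z + \<mu> *\<^sub>R r = x' + p"
    using full unfolding Range_id_plus_eq_UNIV_iff by metis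
  have p: "p \<in> D" unfolding p_def by (rule prox_in[OF \<epsilon>])
  have zu: "z - u' \<in> D" "f (z - u') \<le> f p"
    using contr[OF z(1) A(2)] p z(2) by (auto simp: x'_def)
  have "norm (u - z) \<le> norm (x - (x' + p))"
    using monotone_op_dist_le[OF mon A(1) z(1) \<mu>] unfolding x_def z(2) .
  then have "(norm (u - z))\<^sup>2 \<le> (norm (x - x' - p))\<^sup>2"
    by (intro power_mono) (auto simp: algebra_simps)
  then have "f (z - u') + (norm (u - u' - (z - u')))\<^sup>2 / (2 * \<epsilon>) \<le> f p + (norm (x - x' - p))\<^sup>2 / (2 * \<epsilon>)"
    using zu(2) \<epsilon> by (intro add_mono divide_right_mono) auto
  then show ?thesis
    using moreau_envelope_le[OF \<epsilon> zu(1), of "u - u'"] unfolding moreau_envelope_def[of _ "_ - _"] x_def x'_def p_def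
    by linarith
qed

text \<open>The tangent at the end point \<open>x + \<mu> e\<close> gives the sign of the gradient there; then \<open>\<mu>\<close> tends to
  \<open>0\<close>.\<close>

lemma (in closed_convex_function) envelope_gradient_nonneg:
  assumes \<epsilon>: "\<epsilon> > 0"
    and le: "\<And>\<mu>. \<mu> > 0 \<Longrightarrow> moreau_envelope \<epsilon> x \<le> moreau_envelope \<epsilon> (x + \<mu> *\<^sub>R e)"
  shows "inner (envelope_gradient \<epsilon> x) e \<ge> 0"
proof -
  have "inner (envelope_gradient \<epsilon> (x + \<mu> *\<^sub>R e)) e \<ge> 0" if \<mu>: "\<mu> > 0" for \<mu>
  proof -
    have "0 \<le> \<mu> * inner (envelope_gradient \<epsilon> (x + \<mu> *\<^sub>R e)) e"
      using moreau_envelope_ge_tangent[OF \<epsilon>, of "x + \<mu> *\<^sub>R e" x] le[OF \<mu>] by simp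
    then show ?thesis using \<mu> by (simp add: zero_le_mult_iff)
  qed
  then have ev: "\<forall>\<^sub>F \<mu> in at_right 0. inner (envelope_gradient \<epsilon> (x + \<mu> *\<^sub>R e)) e \<ge> 0"
    unfolding eventually_at_right_field by (intro exI[of _ 1]) auto
  have "((\<lambda>\<mu>. x + \<mu> *\<^sub>R e) \<longlongrightarrow> x + 0 *\<^sub>R e) (at_right 0)" by (intro tendsto_intros)
  then have "((\<lambda>\<mu>. inner (envelope_gradient \<epsilon> (x + \<mu> *\<^sub>R e)) e) \<longlongrightarrow> inner (envelope_gradient \<epsilon> x) e) (at_right 0)"
    by (intro tendsto_inner tendsto_const isCont_tendsto_compose[OF isCont_envelope_gradient[OF \<epsilon>]]) simp
  from tendsto_lowerbound[OF this ev] show ?thesis by simp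
qed

lemma closed_convex_function_ereal:
  fixes \<phi> :: "'h::{real_inner, complete_space} \<Rightarrow> ereal"
  assumes conv: "convex_fun \<phi>" and proper: "proper_fun \<phi>" and lsc: "lsc_fun \<phi>"
  shows "closed_convex_function {x. \<phi> x \<noteq> \<infinity>} (\<lambda>x. real_of_ereal (\<phi> x))"
proof
  have fin: "ereal (real_of_ereal (\<phi> x)) = \<phi> x" if "\<phi> x \<noteq> \<infinity>" for x
    using proper that unfolding proper_fun_def by (cases "\<phi> x") auto
  show "{x. \<phi> x \<noteq> \<infinity>} \<noteq> {}" using proper unfolding proper_fun_def by auto
  have comb: "\<phi> ((1 - t) *\<^sub>R x + t *\<^sub>R y) \<le> ereal ((1 - t) * real_of_ereal (\<phi> x) + t * real_of_ereal (\<phi> y))"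
    if "0 \<le> t" "t \<le> 1" "\<phi> x \<noteq> \<infinity>" "\<phi> y \<noteq> \<infinity>" for t x y
  proof -
    have "\<phi> ((1 - t) *\<^sub>R x + t *\<^sub>R y) \<le> ereal (1 - t) * \<phi> x + ereal t * \<phi> y"
      using conv that(1,2) unfolding convex_fun_def by auto
    also have "\<dots> = ereal (1 - t) * ereal (real_of_ereal (\<phi> x)) + ereal t * ereal (real_of_ereal (\<phi> y))"
      using fin that by simp
    finally show ?thesis by simp
  qed
  have dom: "convex {x. \<phi> x \<noteq> \<infinity>}"
    unfolding convex_alt using comb by fastforce
  show "convex_on {x. \<phi> x \<noteq> \<infinity>} (\<lambda>x. real_of_ereal (\<phi> x))"
  proof (rule convex_onI[OF _ dom])
    fix t :: real and x y
    assume t: "0 < t" "t < 1" and xy: "x \<in> {x. \<phi> x \<noteq> \<infinity>}" "y \<in> {x. \<phi> x \<noteq> \<infinity>}"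
    have le: "\<phi> ((1 - t) *\<^sub>R x + t *\<^sub>R y)
        \<le> ereal ((1 - t) * real_of_ereal (\<phi> x) + t * real_of_ereal (\<phi> y))"
      using comb[of t x y] t xy by auto
    then have nt: "\<phi> ((1 - t) *\<^sub>R x + t *\<^sub>R y) \<noteq> \<infinity>" by auto
    have "ereal (real_of_ereal (\<phi> ((1 - t) *\<^sub>R x + t *\<^sub>R y)))
        \<le> ereal ((1 - t) * real_of_ereal (\<phi> x) + t * real_of_ereal (\<phi> y))"
      unfolding fin[OF nt] by (rule le)
    then show "real_of_ereal (\<phi> ((1 - t) *\<^sub>R x + t *\<^sub>R y))
      \<le> (1 - t) * real_of_ereal (\<phi> x) + t * real_of_ereal (\<phi> y)"
      by simp
  qed
  show "closed {x \<in> {x. \<phi> x \<noteq> \<infinity>}. real_of_ereal (\<phi> x) \<le> c}" for c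
  proof -
    have "\<forall>\<^sub>F y in nhds x. ereal c < \<phi> y" if x: "ereal c < \<phi> x" for x
    proof -
      have "ereal c < Liminf (at x) \<phi>" using lsc x unfolding lsc_fun_def by (metis less_le_trans)
      then show ?thesis using less_LiminfD x by (auto simp: eventually_nhds_conv_at)
    qed
    then have "open {x. ereal c < \<phi> x}"
      by (subst open_subopen) (force simp: eventually_nhds)
    moreover have "{x \<in> {x. \<phi> x \<noteq> \<infinity>}. real_of_ereal (\<phi> x) \<le> c} = - {x. ereal c < \<phi> x}"
    proof -
      have "\<phi> x \<noteq> \<infinity> \<and> real_of_ereal (\<phi> x) \<le> c \<longleftrightarrow> \<not> ereal c < \<phi> x" for x
        using proper unfolding proper_fun_def by (cases "\<phi> x") auto
      then show ?thesis by auto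
    qed
    ultimately show ?thesis by (simp add: closed_def)
  qed
qed

section \<open>Smooth steps as test functions\<close>

text \<open>Differentiating \<open>exp (-1/q)\<close> with \<open>q = (x - a) (b - x)\<close> yields functions of the same form with
  another polynomial and a higher power of \<open>q\<close> in the denominator. Carrying these two as parameters
  makes the family closed under differentiation.\<close>

definition bump :: "real \<Rightarrow> real \<Rightarrow> real poly \<Rightarrow> nat \<Rightarrow> real \<Rightarrow> real" where
  "bump a b p k x = (if a < x \<and> x < b
     then poly p x / ((x - a) * (b - x)) ^ k * exp (- 1 / ((x - a) * (b - x))) else 0)"

lemma exp_minus_inverse_le:
  fixes q :: real
  assumes "q > 0"
  shows "exp (- 1 / q) \<le> fact n * q ^ n"
proof -
  have "(1 / q) ^ n / fact n \<le> exp (1 / q)"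
  proof -
    have "(\<Sum>k\<in>{n}. (1 / q) ^ k /\<^sub>R fact k) \<le> (\<Sum>k. (1 / q) ^ k /\<^sub>R fact k)"
      using assms by (intro sum_le_suminf summable_exp_generic) auto
    then show ?thesis by (simp add: exp_def field_simps)
  qed
  then show ?thesis using assms by (simp add: exp_minus field_simps)
qed

text \<open>At the end points the exponential beats every negative power of \<open>q\<close>. A quadratic bound is what makes
  the derivative at the end points exist and vanish.\<close>

lemma bump_quadratic_bound:
  assumes "a < b"
  obtains C where "\<And>x. \<bar>bump a b p k x\<bar> \<le> C * (x - a)\<^sup>2" "\<And>x. \<bar>bump a b p k x\<bar> \<le> C * (x - b)\<^sup>2"
proof -
  have "compact (poly p ` {a..b})"
    by (intro compact_continuous_image continuous_intros compact_Icc)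
  then obtain M where M: "\<And>x. x \<in> {a..b} \<Longrightarrow> \<bar>poly p x\<bar> \<le> M" "M > 0"
    using bounded_pos[of "poly p ` {a..b}"] compact_imp_bounded by fastforce
  define C where "C = M * fact (k + 2) * (b - a)\<^sup>2"
  have C: "C \<ge> 0" using M(2) by (simp add: C_def)
  have main: "\<bar>bump a b p k x\<bar> \<le> M * fact (k + 2) * ((x - a)\<^sup>2 * (b - x)\<^sup>2)" if x: "a < x" "x < b" for x
  proof -
    define q where "q = (x - a) * (b - x)"
    have q: "q > 0" using x by (simp add: q_def)
    have "\<bar>bump a b p k x\<bar> = \<bar>poly p x\<bar> / q ^ k * exp (- 1 / q)"
      using x q unfolding bump_def q_def[symmetric] by (simp add: abs_mult)
    also have "\<dots> \<le> M / q ^ k * (fact (k + 2) * q ^ (k + 2))"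
      using M x q by (intro mult_mono divide_right_mono exp_minus_inverse_le) auto
    also have "\<dots> = M * fact (k + 2) * q\<^sup>2" using q by (simp add: power_add power2_eq_square)
    finally show ?thesis by (simp add: q_def power_mult_distrib)
  qed
  show ?thesis
  proof
    fix x
    show "\<bar>bump a b p k x\<bar> \<le> C * (x - a)\<^sup>2"
    proof (cases "a < x \<and> x < b")
      case True
      then have "(x - a)\<^sup>2 * (b - x)\<^sup>2 \<le> (x - a)\<^sup>2 * (b - a)\<^sup>2" by (intro mult_left_mono power_mono) auto
      then have "M * fact (k + 2) * ((x - a)\<^sup>2 * (b - x)\<^sup>2) \<le> M * fact (k + 2) * ((x - a)\<^sup>2 * (b - a)\<^sup>2)"
        by (rule mult_left_mono) (use M(2) in simp)
      with main[of x] True show ?thesis by (simp add: C_def mult_ac del: fact_Suc)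
    qed (use C in \<open>auto simp: bump_def\<close>)
    show "\<bar>bump a b p k x\<bar> \<le> C * (x - b)\<^sup>2"
    proof (cases "a < x \<and> x < b")
      case True
      then have "(x - a)\<^sup>2 * (b - x)\<^sup>2 \<le> (b - a)\<^sup>2 * (b - x)\<^sup>2"
        by (intro mult_right_mono power_mono) auto
      then have "M * fact (k + 2) * ((x - a)\<^sup>2 * (b - x)\<^sup>2) \<le> M * fact (k + 2) * ((b - a)\<^sup>2 * (b - x)\<^sup>2)"
        by (rule mult_left_mono) (use M(2) in simp)
      with main[of x] True show ?thesis by (simp add: C_def mult_ac power2_commute[of x b] del: fact_Suc)
    qed (use C in \<open>auto simp: bump_def\<close>)
  qed
qed

lemma has_real_derivative_zero_if_quadratic_bound:
  fixes f :: "real \<Rightarrow> real"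
  assumes "\<And>y. \<bar>f y\<bar> \<le> C * (y - x)\<^sup>2"
  shows "(f has_real_derivative 0) (at x)"
proof -
  have f0: "f x = 0" using assms[of x] by simp
  have "((\<lambda>y. (f y - f x) / (y - x)) \<longlongrightarrow> 0) (at x)"
  proof (rule Lim_null_comparison)
    show "\<forall>\<^sub>F y in at x. norm ((f y - f x) / (y - x)) \<le> C * \<bar>y - x\<bar>"
      unfolding eventually_at_filter
    proof (intro always_eventually allI impI)
      fix y assume "y \<noteq> x"
      then show "norm ((f y - f x) / (y - x)) \<le> C * \<bar>y - x\<bar>"
        using assms[of y] unfolding f0 by (simp add: divide_le_eq power2_eq_square mult.assoc abs_mult_self_eq)
    qed
    have "((\<lambda>y. C * \<bar>y - x\<bar>) \<longlongrightarrow> C * \<bar>x - x\<bar>) (at x)" by (intro tendsto_intros)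
    then show "((\<lambda>y. C * \<bar>y - x\<bar>) \<longlongrightarrow> 0) (at x)" by simp
  qed
  then show ?thesis by (simp add: has_field_derivative_iff)
qed

text \<open>For all \<open>x\<close>, end points included, with one polynomial \<open>r\<close>: on \<open>(a, b)\<close> this is the quotient rule, the
  powers of \<open>q\<close> being brought over the common denominator \<open>q ^ (k + 2)\<close>.\<close>

lemma bump_has_derivative:
  assumes ab: "a < b"
  obtains r where "\<And>x. (bump a b p k has_real_derivative bump a b r (k + 2) x) (at x)"
proof
  define q where "q = [:- (a * b), a + b, - 1:]"
  define r where "r = pderiv p * q * q - smult (of_nat k) (p * pderiv q * q) + p * pderiv q"
  fix x
  have q: "poly q y = (y - a) * (b - y)" for y by (simp add: q_def algebra_simps)
  show "(bump a b p k has_real_derivative bump a b r (k + 2) x) (at x)"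
  proof -
    consider "a < x \<and> x < b" | "x = a" | "x = b" | "x < a \<or> b < x" by linarith
    then show ?thesis
    proof cases
      case 1
      define Q where "Q = poly q x"
      have Q: "Q > 0" using 1 by (simp add: Q_def q)
      have "((\<lambda>y. poly p y / poly q y ^ k * exp (- 1 / poly q y)) has_real_derivative
          (poly (pderiv p) x / Q ^ k - poly p x * (of_nat k * Q ^ (k - 1) * poly (pderiv q) x) / (Q ^ k * Q ^ k)) * exp (- 1 / Q)
          + poly p x / Q ^ k * (exp (- 1 / Q) * (poly (pderiv q) x / (Q * Q)))) (at x)"
        using Q unfolding Q_def
        by (auto intro!: derivative_eq_intros poly_DERIV simp: field_simps)
      also have "(poly (pderiv p) x / Q ^ k - poly p x * (of_nat k * Q ^ (k - 1) * poly (pderiv q) x) / (Q ^ k * Q ^ k)) * exp (- 1 / Q)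
          + poly p x / Q ^ k * (exp (- 1 / Q) * (poly (pderiv q) x / (Q * Q))) = poly r x / Q ^ (k + 2) * exp (- 1 / Q)"
      proof -
        have "of_nat k * Q ^ (k - 1) = of_nat k * Q ^ k / Q" using Q by (cases k) auto
        then show ?thesis using Q by (auto simp: r_def Q_def[symmetric] field_simps power_add)
      qed
      also have "\<dots> = bump a b r (k + 2) x" using 1 by (simp add: bump_def Q_def q)
      finally have D: "((\<lambda>y. poly p y / poly q y ^ k * exp (- 1 / poly q y)) has_real_derivative bump a b r (k + 2) x) (at x)" .
      show ?thesis
        by (rule has_field_derivative_transform_within_open[OF D, of "{a<..<b}"]) (use 1 in \<open>auto simp: bump_def q\<close>)
    next
      case 2
      obtain C where "\<And>y. \<bar>bump a b p k y\<bar> \<le> C * (y - a)\<^sup>2" using bump_quadratic_bound[OF ab] by metis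
      moreover have "bump a b r (k + 2) x = 0" using 2 by (simp add: bump_def)
      ultimately show ?thesis using has_real_derivative_zero_if_quadratic_bound 2 by metis
    next
      case 3
      obtain C where "\<And>y. \<bar>bump a b p k y\<bar> \<le> C * (y - b)\<^sup>2" using bump_quadratic_bound[OF ab] by metis
      moreover have "bump a b r (k + 2) x = 0" using 3 by (simp add: bump_def)
      ultimately show ?thesis using has_real_derivative_zero_if_quadratic_bound 3 by metis
    next
      case 4
      have "((\<lambda>y. 0) has_real_derivative bump a b r (k + 2) x) (at x)" using 4 by (auto simp: bump_def)
      then show ?thesis
        by (rule has_field_derivative_transform_within_open[of _ _ _ "- {a..b}"])
          (use 4 in \<open>auto simp: bump_def open_Compl\<close>)
    qed
  qed
qed

text \<open>Smoothness by coinduction: a set of functions in which every member has its derivative is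
  closed under all iterated derivatives.\<close>

lemma iterated_deriv_in:
  assumes step: "\<And>f. f \<in> S \<Longrightarrow> \<exists>g\<in>S. \<forall>x. (f has_real_derivative g x) (at x)" and f: "f \<in> S"
  shows "(deriv ^^ n) f \<in> S"
proof (induction n)
  case (Suc n)
  then obtain g where g: "g \<in> S" "\<forall>x. ((deriv ^^ n) f has_real_derivative g x) (at x)" using step by blast
  then have "deriv ((deriv ^^ n) f) = g" by (auto intro: DERIV_imp_deriv)
  with g show ?case by simp
qed (simp add: f)

text \<open>The normalized primitive of a bump.\<close>

lemma smooth_step_exists:
  fixes a c :: real
  assumes ac: "a < c"
  obtains R p where "\<And>x. (R has_real_derivative bump a c p 0 x) (at x)"
    "\<And>x. bump a c p 0 x \<ge> 0" "\<And>x. x \<le> a \<Longrightarrow> R x = 0" "\<And>x. x \<ge> c \<Longrightarrow> R x = 1" "\<And>x. 0 \<le> R x \<and> R x \<le> 1"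
proof -
  define \<rho> where "\<rho> = bump a c 1 0"
  define G where "G = (\<lambda>u::real. LBINT y=a..u. \<rho> y)"
  have cont: "continuous_on S \<rho>" for S
    unfolding \<rho>_def using bump_has_derivative[OF ac, of 1 0]
    by (metis DERIV_isCont continuous_at_imp_continuous_on)
  have G: "(G has_real_derivative \<rho> x) (at x)" for x
  proof -
    define l where "l = min a x - 1"
    define h where "h = max a x + 1"
    have "(G has_vector_derivative \<rho> x) (at x within {l..h})"
      unfolding G_def by (rule interval_integral_FTC2[OF _ _ cont]) (auto simp: l_def h_def)
    moreover have "at x within {l..h} = at x"
      by (rule at_within_interior) (auto simp: l_def h_def)
    ultimately show ?thesis by (simp add: has_real_derivative_iff_has_vector_derivative)
  qed
  have Ga: "G a = 0" by (simp add: G_def)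
  have pos: "\<rho> x \<ge> 0" for x by (simp add: \<rho>_def bump_def)
  have mono: "G x \<le> G y" if "x \<le> y" for x y
    by (rule DERIV_nonneg_imp_nondecreasing[OF that]) (use G pos in blast)
  have "G a < G c"
  proof (rule DERIV_pos_imp_increasing_open[OF ac])
    show "\<exists>y. (G has_real_derivative y) (at x) \<and> 0 < y" if "a < x" "x < c" for x
      using G[of x] that by (intro exI[of _ "\<rho> x"]) (auto simp: \<rho>_def bump_def)
    show "continuous_on {a..c} G" using G DERIV_isCont continuous_at_imp_continuous_on by blast
  qed
  then have Gc: "G c > 0" using Ga by simp
  have const: "G u = G v" if uv: "u < v" and z: "\<And>z. u < z \<Longrightarrow> z < v \<Longrightarrow> \<rho> z = 0" for u v
  proof (rule sym, rule DERIV_isconst_end[OF uv])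
    show "continuous_on {u..v} G" using G DERIV_isCont continuous_at_imp_continuous_on by blast
    show "(G has_real_derivative 0) (at x)" if "u < x" "x < v" for x
      using G[of x] z[OF that] by simp
  qed
  have Gle: "G x = 0" if "x \<le> a" for x
  proof (cases "x = a")
    case False
    then show ?thesis using const[of x a] that unfolding Ga by (simp add: \<rho>_def bump_def)
  qed (simp add: Ga)
  have Gge: "G x = G c" if "x \<ge> c" for x
  proof (cases "x = c")
    case False
    then show ?thesis using const[of c x] that by (simp add: \<rho>_def bump_def)
  qed simp
  show ?thesis
  proof
    have eq: "bump a c [:1 / G c:] 0 x = \<rho> x / G c" for x by (simp add: \<rho>_def bump_def)
    show "((\<lambda>x. G x / G c) has_real_derivative bump a c [:1 / G c:] 0 x) (at x)" for x
      unfolding eq by (rule DERIV_cdivide[OF G])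
    show "bump a c [:1 / G c:] 0 x \<ge> 0" for x unfolding eq using pos Gc by simp
    show "G x / G c = 0" if "x \<le> a" for x using Gle[OF that] by simp
    show "G x / G c = 1" if "x \<ge> c" for x using Gge[OF that] Gc by simp
    show "0 \<le> G x / G c \<and> G x / G c \<le> 1" for x
      using mono[of a x] mono[of x a] mono[of x c] mono[of c x] Gle[of x] Gge[of x] Ga Gc
      by (cases "x \<le> a"; cases "x \<ge> c") auto
  qed
qed

section \<open>Scalar components of Bochner integrals\<close>

lemma complete_measure_lebesgue_on:
  assumes "S \<in> sets lebesgue"
  shows "complete_measure (lebesgue_on S)"
proof
  fix A B :: "'a set" assume "B \<subseteq> A" "A \<in> null_sets (lebesgue_on S)"
  then have "B \<subseteq> S" "B \<in> null_sets lebesgue"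
    using assms completion.complete2 by (auto simp: null_sets_restrict_space)
  then show "B \<in> sets (lebesgue_on S)"
    using assms by (auto simp: null_sets_def sets_restrict_space_iff)
qed

text \<open>Completeness of the measure is essential, since \<open>f\<close> is arbitrary on the exceptional null set.\<close>

lemma (in complete_measure) borel_measurable_AE_limit:
  fixes f :: "'a \<Rightarrow> real"
  assumes g: "\<And>i. g i \<in> borel_measurable M" and lim: "AE x in M. (\<lambda>i. g i x) \<longlonglongrightarrow> f x"
  shows "f \<in> borel_measurable M"
proof (rule measurableI)
  fix B :: "real set" assume B: "B \<in> sets borel"
  have h: "(\<lambda>x. lim (\<lambda>i. g i x)) \<in> borel_measurable M" using g by measurable
  show "f -` B \<inter> space M \<in> sets M"
  proof (rule in_sets_AE)
    show "AE x in M. (x \<in> (\<lambda>x. lim (\<lambda>i. g i x)) -` B \<inter> space M) = (x \<in> f -` B \<inter> space M)"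
      using lim by eventually_elim (auto simp: limI)
    show "(\<lambda>x. lim (\<lambda>i. g i x)) -` B \<inter> space M \<in> sets M" using h B by (rule measurable_sets)
  qed auto
qed auto

text \<open>Real-valued continuous images turn strong measurability into Borel measurability, whatever the
  topology of the value space. The simple function \<open>s\<close> accommodates the integrands \<open>\<parallel>f - s\<parallel>\<close> that
  occur in the definition of the Bochner integral.\<close>

lemma (in complete_measure) strongly_measurable_compose2:
  fixes h :: "'b::real_normed_vector \<Rightarrow> 'c \<Rightarrow> real"
  assumes f: "strongly_measurable M f" and s: "simple_function M s" and h: "\<And>x y. isCont (\<lambda>x. h x y) x"
  shows "(\<lambda>x. h (f x) (s x)) \<in> borel_measurable M"
proof -
  obtain S where S: "\<And>i. simple_function M (S i)" "AE x in M. (\<lambda>i. S i x) \<longlonglongrightarrow> f x"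
    using f unfolding strongly_measurable_def by blast
  show ?thesis
  proof (rule borel_measurable_AE_limit)
    show "(\<lambda>x. h (S i x) (s x)) \<in> borel_measurable M" for i
      by (rule borel_measurable_simple_function, rule simple_function_compose2[OF S(1) s])
    show "AE x in M. (\<lambda>i. h (S i x) (s x)) \<longlonglongrightarrow> h (f x) (s x)"
      using S(2) by eventually_elim (rule isCont_tendsto_compose[OF h])
  qed
qed

text \<open>The approximating simple functions may be paired with \<open>g\<close>, which commutes with their integrals and
  changes the error by at most the factor \<open>\<parallel>g\<parallel>\<close>.\<close>

lemma (in complete_measure) has_strong_bochner_integral_inner:
  fixes f :: "'a \<Rightarrow> 'h::real_inner"
  assumes "has_strong_bochner_integral M f y"
  shows "has_bochner_integral M (\<lambda>x. inner g (f x)) (inner g y)"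
proof -
  obtain S where f: "strongly_measurable M f"
    and S: "\<And>i. Bochner_Integration.simple_bochner_integrable M (S i)"
    and lim: "(\<lambda>i. \<integral>\<^sup>+x. ennreal (norm (f x - S i x)) \<partial>M) \<longlonglongrightarrow> 0"
    and int: "(\<lambda>i. Bochner_Integration.simple_bochner_integral M (S i)) \<longlonglongrightarrow> y"
    using assms unfolding has_strong_bochner_integral_def by blast
  have simple: "simple_function M (S i)" for i
    using S[of i] by (auto elim: Bochner_Integration.simple_bochner_integrable.cases)
  show ?thesis
  proof (rule has_bochner_integral.intros)
    show "(\<lambda>x. inner g (f x)) \<in> borel_measurable M"
      using strongly_measurable_compose2[OF f simple_function_const, of "\<lambda>x (_::real). inner g x"]
      by (auto intro!: continuous_intros)
    show "Bochner_Integration.simple_bochner_integrable M (\<lambda>x. inner g (S i x))" for i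
      by (rule simple_bochner_integrable_compose2[where p = "\<lambda>x y. inner g x", OF _ S S]) simp
    have norm_meas: "(\<lambda>x. norm (f x - S i x)) \<in> borel_measurable M" for i
      by (rule strongly_measurable_compose2[OF f simple, of "\<lambda>x y. norm (x - y)"])
        (auto intro!: continuous_intros)
    have bd: "(\<integral>\<^sup>+x. ennreal (norm (inner g (f x) - inner g (S i x))) \<partial>M)
        \<le> ennreal (norm g) * (\<integral>\<^sup>+x. ennreal (norm (f x - S i x)) \<partial>M)" for i
    proof -
      have "(\<integral>\<^sup>+x. ennreal (norm (inner g (f x) - inner g (S i x))) \<partial>M)
          \<le> (\<integral>\<^sup>+x. ennreal (norm g) * ennreal (norm (f x - S i x)) \<partial>M)"
        by (intro nn_integral_mono)
          (auto simp: inner_diff_right[symmetric] ennreal_mult[symmetric] Cauchy_Schwarz_ineq2 intro!: ennreal_leI)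
      also have "\<dots> = ennreal (norm g) * (\<integral>\<^sup>+x. ennreal (norm (f x - S i x)) \<partial>M)"
        by (rule nn_integral_cmult) (use norm_meas in measurable)
      finally show ?thesis .
    qed
    have "(\<lambda>i. ennreal (norm g) * (\<integral>\<^sup>+x. ennreal (norm (f x - S i x)) \<partial>M)) \<longlonglongrightarrow> ennreal (norm g) * 0"
      by (rule ennreal_tendsto_cmult[OF _ lim]) simp
    then have lim': "(\<lambda>i. ennreal (norm g) * (\<integral>\<^sup>+x. ennreal (norm (f x - S i x)) \<partial>M)) \<longlonglongrightarrow> 0"
      by simp
    show "(\<lambda>i. \<integral>\<^sup>+x. ennreal (norm (inner g (f x) - inner g (S i x))) \<partial>M) \<longlonglongrightarrow> 0"
      by (rule tendsto_sandwich[OF always_eventually always_eventually tendsto_const lim'])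
        (simp, blast intro: bd)
    have "(\<lambda>i. inner g (Bochner_Integration.simple_bochner_integral M (S i))) \<longlonglongrightarrow> inner g y"
      by (intro tendsto_intros int)
    then show "(\<lambda>i. Bochner_Integration.simple_bochner_integral M (\<lambda>x. inner g (S i x))) \<longlonglongrightarrow> inner g y"
      by (subst simple_bochner_integral_linear[OF _ S]) (auto intro: bounded_linear.linear[OF bounded_linear_inner_right])
  qed
qed

lemma weak_deriv_inner:
  fixes f :: "real \<Rightarrow> 'h::real_inner"
  assumes "weak_deriv {0<..} f f'" "test_function {0<..} \<psi>"
  obtains c where "has_bochner_integral (lebesgue_on {0<..}) (\<lambda>t. deriv \<psi> t * inner g (f t)) c"
    "has_bochner_integral (lebesgue_on {0<..}) (\<lambda>t. \<psi> t * inner g (f' t)) (- c)"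
proof -
  interpret complete_measure "lebesgue_on {0::real<..}" by (rule complete_measure_lebesgue_on) simp
  obtain y where
    "has_strong_bochner_integral (lebesgue_on {0<..}) (\<lambda>t. deriv \<psi> t *\<^sub>R f t) y"
    "has_strong_bochner_integral (lebesgue_on {0<..}) (\<lambda>t. \<psi> t *\<^sub>R f' t) (- y)"
    using assms unfolding weak_deriv_def by blast
  from this[THEN has_strong_bochner_integral_inner[of _ _ g]] show ?thesis
    by (intro that[of "inner g y"]) simp_all
qed

text \<open>The weak first derivative is eliminated by testing with \<open>\<psi>\<close> and with its derivative: the weak
  derivatives are determined only almost everywhere, so that \<open>v'\<close> need not be the classical derivative.\<close>

lemma W22_loc_inner:
  fixes v :: "real \<Rightarrow> 'h::real_inner"
  assumes v: "W22_loc {0<..} v v' v''"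
    and \<psi>: "test_function {0<..} \<psi>" "test_function {0<..} (deriv \<psi>)"
  obtains c where
    "has_bochner_integral (lebesgue_on {0<..}) (\<lambda>t. deriv (deriv \<psi>) t * inner g (v t)) c"
    "has_bochner_integral (lebesgue_on {0<..}) (\<lambda>t. \<psi> t * inner g (v'' t)) c"
proof -
  have w: "weak_deriv {0<..} v v'" "weak_deriv {0<..} v' v''" using v unfolding W22_loc_def by auto
  obtain c where c:
    "has_bochner_integral (lebesgue_on {0<..}) (\<lambda>t. deriv (deriv \<psi>) t * inner g (v t)) c"
    "has_bochner_integral (lebesgue_on {0<..}) (\<lambda>t. deriv \<psi> t * inner g (v' t)) (- c)"
    by (rule weak_deriv_inner[OF w(1) \<psi>(2)])
  obtain d where d:
    "has_bochner_integral (lebesgue_on {0<..}) (\<lambda>t. deriv \<psi> t * inner g (v' t)) d"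
    "has_bochner_integral (lebesgue_on {0<..}) (\<lambda>t. \<psi> t * inner g (v'' t)) (- d)"
    by (rule weak_deriv_inner[OF w(2) \<psi>(1)])
  have "- c = d" using c(2) d(1) by (rule has_bochner_integral_eq)
  with c(1) d(2) show ?thesis by (intro that[of c]) auto
qed

text \<open>The dominating function is \<open>1 + \<parallel>f\<parallel>\<^sup>2\<close>.\<close>

lemma L2_loc_integrable_norm:
  fixes f :: "real \<Rightarrow> 'h::real_inner"
  assumes f: "L2_loc {0<..} f" and a: "0 < a"
  shows "integrable (lebesgue_on {a..b}) (\<lambda>t. norm (f t))"
    and "integrable (lebesgue_on {a..b}) (\<lambda>t. inner g (f t))"
proof -
  interpret complete_measure "lebesgue_on {0::real<..}" by (rule complete_measure_lebesgue_on) simp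
  have sub: "{a..b} \<subseteq> {0<..}" using a by auto
  have sm: "strongly_measurable (lebesgue_on {0<..}) f"
    and fin: "(\<integral>\<^sup>+t. ennreal ((norm (f t))\<^sup>2) \<partial>lebesgue_on {a..b}) < \<infinity>"
    using f sub compact_Icc[of a b] unfolding L2_loc_def by blast+
  have "(\<lambda>t. norm (f t)) \<in> borel_measurable (lebesgue_on {0<..})"
    using strongly_measurable_compose2[OF sm simple_function_const, of "\<lambda>x (_::real). norm x"]
    by (auto intro!: continuous_intros)
  then have m1: "(\<lambda>t. norm (f t)) \<in> borel_measurable (lebesgue_on {a..b})"
    by (rule measurable_restrict_mono[OF _ sub])
  have "(\<lambda>t. inner g (f t)) \<in> borel_measurable (lebesgue_on {0<..})"
    using strongly_measurable_compose2[OF sm simple_function_const, of "\<lambda>x (_::real). inner g x"]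
    by (auto intro!: continuous_intros)
  then have m2: "(\<lambda>t. inner g (f t)) \<in> borel_measurable (lebesgue_on {a..b})"
    by (rule measurable_restrict_mono[OF _ sub])
  have "integrable (lebesgue_on {a..b}) (\<lambda>t. (norm (f t))\<^sup>2)"
    using m1 fin by (intro integrableI_bounded) auto
  then have dom: "integrable (lebesgue_on {a..b}) (\<lambda>t. 1 + (norm (f t))\<^sup>2)"
    by (intro Bochner_Integration.integrable_add) auto
  have "norm (norm (f t)) \<le> norm (1 + (norm (f t))\<^sup>2)" for t
  proof -
    have "0 \<le> (norm (f t) - 1)\<^sup>2" by simp
    then have "2 * norm (f t) \<le> 1 + (norm (f t))\<^sup>2" by (simp add: power2_eq_square algebra_simps)
    then have "norm (f t) \<le> 1 + (norm (f t))\<^sup>2" using norm_ge_zero[of "f t"] by linarith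
    then show ?thesis by simp
  qed
  then show n: "integrable (lebesgue_on {a..b}) (\<lambda>t. norm (f t))"
    using Bochner_Integration.integrable_bound[OF dom m1] by simp
  show "integrable (lebesgue_on {a..b}) (\<lambda>t. inner g (f t))"
    by (rule Bochner_Integration.integrable_bound[OF integrable_mult_right[OF n, of "norm g"] m2])
      (simp add: Cauchy_Schwarz_ineq2)
qed

section \<open>The weak second derivative of a continuously differentiable function\<close>

lemma bump_eq_0: "x \<le> a \<or> b \<le> x \<Longrightarrow> bump a b p k x = 0"
  by (auto simp: bump_def)

text \<open>A difference of two steps has compact support, as both are \<open>0\<close> far to the left and \<open>1\<close> far to the
  right.\<close>

lemma test_function_step_difference:
  assumes ord: "0 < a" "a < a'" "0 < b" "b < b'"
    and R: "\<And>x. (R has_real_derivative bump a a' p 0 x) (at x)"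
      "\<And>x. x \<le> a \<Longrightarrow> R x = 0" "\<And>x. x \<ge> a' \<Longrightarrow> R x = 1"
    and Q: "\<And>x. (Q has_real_derivative bump b b' q 0 x) (at x)"
      "\<And>x. x \<le> b \<Longrightarrow> Q x = 0" "\<And>x. x \<ge> b' \<Longrightarrow> Q x = 1"
  shows "deriv (\<lambda>x. R x - Q x) = (\<lambda>x. bump a a' p 0 x - bump b b' q 0 x)"
    and "test_function {0<..} (\<lambda>x. R x - Q x)"
    and "test_function {0<..} (\<lambda>x. bump a a' p 0 x - bump b b' q 0 x)"
proof -
  define \<psi> where "\<psi> = (\<lambda>x. R x - Q x)"
  define B where "B = {(\<lambda>x. bump a a' r k x - bump b b' s l x) | r k s l. True}"
  have D: "(\<psi> has_real_derivative bump a a' p 0 x - bump b b' q 0 x) (at x)" for x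
    unfolding \<psi>_def by (intro DERIV_diff R Q)
  show "deriv (\<lambda>x. R x - Q x) = (\<lambda>x. bump a a' p 0 x - bump b b' q 0 x)"
    using D unfolding \<psi>_def by (auto intro: DERIV_imp_deriv)
  have step: "\<exists>g\<in>insert \<psi> B. \<forall>x. (f has_real_derivative g x) (at x)" if "f \<in> insert \<psi> B" for f
  proof -
    from that consider "f = \<psi>" | r k s l where "f = (\<lambda>x. bump a a' r k x - bump b b' s l x)"
      unfolding B_def by blast
    then show ?thesis
    proof cases
      case 1
      have "(\<lambda>x. bump a a' p 0 x - bump b b' q 0 x) \<in> B" unfolding B_def by blast
      then show ?thesis unfolding 1 using D by (intro bexI[of _ "\<lambda>x. bump a a' p 0 x - bump b b' q 0 x"]) auto
    next
      case 2
      obtain r' s' where r': "\<And>x. (bump a a' r k has_real_derivative bump a a' r' (k + 2) x) (at x)"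
        and s': "\<And>x. (bump b b' s l has_real_derivative bump b b' s' (l + 2) x) (at x)"
        using bump_has_derivative[OF ord(2)] bump_has_derivative[OF ord(4)] by metis
      have "(\<lambda>x. bump a a' r' (k + 2) x - bump b b' s' (l + 2) x) \<in> B" unfolding B_def by blast
      moreover have "\<forall>x. (f has_real_derivative (bump a a' r' (k + 2) x - bump b b' s' (l + 2) x)) (at x)"
        unfolding 2 by (intro allI DERIV_diff r' s')
      ultimately show ?thesis
        by (intro bexI[of _ "\<lambda>x. bump a a' r' (k + 2) x - bump b b' s' (l + 2) x"]) auto
    qed
  qed
  have smooth: "(deriv ^^ n) f field_differentiable (at t)" if "f \<in> insert \<psi> B" for f n t
    using step[OF iterated_deriv_in[OF step that]] unfolding field_differentiable_def by blast
  define K where "K = {min a b..max a' b'}"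
  have K: "compact K" "K \<subseteq> {0<..}" using ord by (auto simp: K_def)
  have outside: "\<psi> t = 0 \<and> bump a a' p 0 t - bump b b' q 0 t = 0" if "t \<notin> K" for t
  proof -
    from that consider "t \<le> a" "t \<le> b" | "t \<ge> a'" "t \<ge> b'" unfolding K_def by fastforce
    then show ?thesis by cases (simp_all add: \<psi>_def bump_eq_0 R Q)
  qed
  show "test_function {0<..} (\<lambda>x. R x - Q x)"
    unfolding test_function_def \<psi>_def[symmetric] using smooth[of \<psi>] K outside by blast
  show "test_function {0<..} (\<lambda>x. bump a a' p 0 x - bump b b' q 0 x)"
  proof -
    have "(\<lambda>x. bump a a' p 0 x - bump b b' q 0 x) \<in> insert \<psi> B" unfolding B_def by blast
    from smooth[OF this] show ?thesis unfolding test_function_def using K outside by blast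
  qed
qed

lemma has_integral_shrink:
  fixes f :: "'a::euclidean_space \<Rightarrow> real"
  assumes "(f has_integral i) T" "S \<subseteq> T" "\<And>x. x \<in> T \<Longrightarrow> x \<notin> S \<Longrightarrow> f x = 0"
  shows "(f has_integral i) S"
proof -
  have "((\<lambda>x. if x \<in> S then f x else 0) has_integral i) T"
    using assms(1) by (rule has_integral_eq[rotated]) (use assms(3) in auto)
  then show ?thesis using has_integral_restrict[OF assms(2)] by blast
qed

lemma approximate_identity_right:
  fixes u :: "real \<Rightarrow> real"
  assumes ac: "a < c" and u: "continuous_on {a..c} u"
    and \<rho>: "\<And>n. continuous_on {a..c} (\<rho> n)" "\<And>n x. \<rho> n x \<ge> 0" "\<And>n x. x \<ge> a + \<delta> n \<Longrightarrow> \<rho> n x = 0"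
      "\<And>n. (\<rho> n has_integral 1) {a..c}"
    and \<delta>: "\<delta> \<longlonglongrightarrow> 0"
  shows "(\<lambda>n. integral {a..c} (\<lambda>t. \<rho> n t * u t)) \<longlonglongrightarrow> u a"
proof (rule tendstoI)
  fix \<eta> :: real assume \<eta>: "\<eta> > 0"
  obtain d where d: "d > 0" "\<And>x. x \<in> {a..c} \<Longrightarrow> dist x a < d \<Longrightarrow> dist (u x) (u a) < \<eta> / 2"
    using u ac \<eta> unfolding continuous_on_iff by (metis atLeastAtMost_iff half_gt_zero order_refl less_imp_le)
  have "\<forall>\<^sub>F n in sequentially. \<delta> n < d" using \<delta> d(1) by (rule order_tendstoD(2))
  then show "\<forall>\<^sub>F n in sequentially. dist (integral {a..c} (\<lambda>t. \<rho> n t * u t)) (u a) < \<eta>"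
  proof eventually_elim
    case (elim n)
    have I: "((\<lambda>t. \<rho> n t * u t) has_integral integral {a..c} (\<lambda>t. \<rho> n t * u t)) {a..c}"
      by (intro integrable_integral integrable_continuous_interval continuous_intros \<rho> u)
    have L: "((\<lambda>t. \<rho> n t * r) has_integral r) {a..c}" for r
      using has_integral_mult_left[OF \<rho>(4), of n r] by simp
    have near: "\<bar>u t - u a\<bar> < \<eta> / 2" if "t \<in> {a..c}" "\<rho> n t \<noteq> 0" for t
    proof -
      have "t < a + \<delta> n" using \<rho>(3)[of n t] that(2) by force
      then show ?thesis using d(2)[OF that(1)] elim that(1) by (auto simp: dist_real_def)
    qed
    have cmp: "\<rho> n t * (u a - \<eta> / 2) \<le> \<rho> n t * u t \<and> \<rho> n t * u t \<le> \<rho> n t * (u a + \<eta> / 2)"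
      if "t \<in> {a..c}" for t
    proof (cases "\<rho> n t = 0")
      case False
      have "u a - \<eta> / 2 \<le> u t" "u t \<le> u a + \<eta> / 2" using near[OF that False] by linarith+
      then show ?thesis by (intro conjI mult_left_mono \<rho>(2))
    qed simp
    have "u a - \<eta> / 2 \<le> integral {a..c} (\<lambda>t. \<rho> n t * u t)"
      by (rule has_integral_le[OF L I]) (use cmp in auto)
    moreover have "integral {a..c} (\<lambda>t. \<rho> n t * u t) \<le> u a + \<eta> / 2"
      by (rule has_integral_le[OF I L]) (use cmp in auto)
    ultimately show ?case using \<eta> by (auto simp: dist_real_def abs_less_iff)
  qed
qed

text \<open>Two integrations by parts: the weak formulation moves two derivatives from \<open>v\<close> to the test
  function \<open>R - Q\<close>, and the fundamental theorem of calculus moves one of them back to the continuously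
  differentiable \<open>g \<bullet> v\<close>.\<close>

lemma step_difference_duality:
  fixes v :: "real \<Rightarrow> 'h::real_inner"
  assumes W: "W22_loc {0<..} v v1 v2"
    and v': "\<And>z. z > 0 \<Longrightarrow> (v has_vector_derivative v' z) (at z)" and cont: "continuous_on {0<..} v'"
    and ord: "0 < a" "a < b" "a < a'" "a' \<le> c" "b < b'" "b' \<le> c"
    and R: "\<And>x. (R has_real_derivative bump a a' p 0 x) (at x)"
      "\<And>x. x \<le> a \<Longrightarrow> R x = 0" "\<And>x. x \<ge> a' \<Longrightarrow> R x = 1"
    and Q: "\<And>x. (Q has_real_derivative bump b b' q 0 x) (at x)"
      "\<And>x. x \<le> b \<Longrightarrow> Q x = 0" "\<And>x. x \<ge> b' \<Longrightarrow> Q x = 1"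
  shows "integral\<^sup>L (lebesgue_on {a..c}) (\<lambda>t. (R t - Q t) * inner g (v2 t))
    = integral {a..c} (\<lambda>t. bump b b' q 0 t * inner g (v' t)) - integral {a..c} (\<lambda>t. bump a a' p 0 t * inner g (v' t))"
proof -
  have b: "0 < b" using ord by simp
  define \<psi> where "\<psi> = (\<lambda>x. R x - Q x)"
  define \<psi>' where "\<psi>' = (\<lambda>x. bump a a' p 0 x - bump b b' q 0 x)"
  note T = test_function_step_difference[OF ord(1,3) b ord(5) R Q]
  have \<psi>: "deriv \<psi> = \<psi>'" "test_function {0<..} \<psi>" "test_function {0<..} (deriv \<psi>)"
    using T unfolding \<psi>_def \<psi>'_def by simp_all
  have out: "\<psi> t = 0" "\<psi>' t = 0" if "t \<notin> {a..c}" for t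
  proof -
    from that consider "t \<le> a" "t \<le> b" | "t \<ge> a'" "t \<ge> b'" using ord by fastforce
    then show "\<psi> t = 0" "\<psi>' t = 0"
      by (cases; simp add: \<psi>_def \<psi>'_def bump_eq_0 R Q)+
  qed
  have ends: "\<psi>' a = 0" "\<psi>' c = 0" using ord by (auto simp: \<psi>'_def bump_eq_0)
  have D\<psi>': "(\<psi>' has_real_derivative deriv \<psi>' t) (at t)" for t
    using \<psi>(3) unfolding \<psi>(1) test_function_def by (metis DERIV_deriv_iff_field_differentiable funpow_0)
  have out'': "deriv \<psi>' t = 0" if "t \<notin> {a..c}" for t
  proof -
    have "((\<lambda>_. 0) has_real_derivative 0) (at t)" by simp
    then have "(\<psi>' has_real_derivative 0) (at t)"
      by (rule has_field_derivative_transform_within_open[of _ _ _ "- {a..c}"])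
        (use that out(2) in \<open>auto simp: open_Compl\<close>)
    then show ?thesis by (rule DERIV_imp_deriv)
  qed
  obtain m where m: "has_bochner_integral (lebesgue_on {0<..}) (\<lambda>t. deriv \<psi>' t * inner g (v t)) m"
    "has_bochner_integral (lebesgue_on {0<..}) (\<lambda>t. \<psi> t * inner g (v2 t)) m"
    by (rule W22_loc_inner[OF W \<psi>(2,3), unfolded \<psi>(1)])
  have HK: "(f has_integral m) {0<..}" if "has_bochner_integral (lebesgue_on {0<..}) f m" for f :: "real \<Rightarrow> real"
    using has_integral_integral_lebesgue_on[of "{0<..}" f] that by (auto simp: has_bochner_integral_iff)
  have sub: "{a..c} \<subseteq> {0<..}" using ord by auto
  have "((\<lambda>t. \<psi> t * inner g (v2 t)) has_integral m) {a..c}"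
    by (rule has_integral_shrink[OF HK[OF m(2)] sub]) (simp add: out)
  moreover have "integrable (lebesgue_on {a..c}) (\<lambda>t. \<psi> t * inner g (v2 t))"
  proof -
    have "integrable (lebesgue_on {0<..}) (\<lambda>t. \<psi> t * inner g (v2 t))"
      using m(2) by (auto simp: has_bochner_integral_iff)
    then have "set_integrable lebesgue {0<..} (\<lambda>t. \<psi> t * inner g (v2 t))"
      by (simp add: set_integrable_def integrable_restrict_space)
    then have "set_integrable lebesgue {a..c} (\<lambda>t. \<psi> t * inner g (v2 t))"
      by (rule set_integrable_subset) (use sub in auto)
    then show ?thesis by (simp add: set_integrable_def integrable_restrict_space)
  qed
  ultimately have lhs: "integral\<^sup>L (lebesgue_on {a..c}) (\<lambda>t. \<psi> t * inner g (v2 t)) = m"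
    using lebesgue_integral_eq_integral[of "{a..c}" "\<lambda>t. \<psi> t * inner g (v2 t)"]
    by (metis fmeasurableD lmeasurable_interval(1) integral_unique)
  have I2: "((\<lambda>t. deriv \<psi>' t * inner g (v t)) has_integral m) {a..c}"
    by (rule has_integral_shrink[OF HK[OF m(1)] sub]) (simp add: out'')
  have Dg: "((\<lambda>t. inner g (v t)) has_real_derivative inner g (v' t)) (at t)" if "t > 0" for t
    using bounded_linear.has_vector_derivative[OF bounded_linear_inner_right v'[OF that], of g]
    by (simp add: has_real_derivative_iff_has_vector_derivative)
  have "((\<lambda>t. deriv \<psi>' t * inner g (v t) + inner g (v' t) * \<psi>' t) has_integral
      \<psi>' c * inner g (v c) - \<psi>' a * inner g (v a)) {a..c}"
  proof (rule fundamental_theorem_of_calculus)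
    show "a \<le> c" using ord by simp
    show "((\<lambda>t. \<psi>' t * inner g (v t)) has_vector_derivative
        deriv \<psi>' t * inner g (v t) + inner g (v' t) * \<psi>' t) (at t within {a..c})" if "t \<in> {a..c}" for t
    proof -
      have "t > 0" using that ord by simp
      from DERIV_mult[OF D\<psi>' Dg[OF this]] show ?thesis
        unfolding has_real_derivative_iff_has_vector_derivative by (rule has_vector_derivative_at_within)
    qed
  qed
  then have "((\<lambda>t. deriv \<psi>' t * inner g (v t) + inner g (v' t) * \<psi>' t) has_integral 0) {a..c}"
    by (simp add: ends)
  from has_integral_diff[OF this I2]
  have I1: "((\<lambda>t. inner g (v' t) * \<psi>' t) has_integral (- m)) {a..c}" by simp
  have cb: "continuous_on S (bump l h r 0)" if "l < h" for S l h r
    using bump_has_derivative[OF that, of r 0] by (metis DERIV_isCont continuous_at_imp_continuous_on)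
  have cu: "continuous_on {a..c} (\<lambda>t. inner g (v' t))"
    by (intro continuous_intros continuous_on_subset[OF cont sub])
  have "integral {a..c} (\<lambda>t. bump a a' p 0 t * inner g (v' t) - bump b b' q 0 t * inner g (v' t))
      = integral {a..c} (\<lambda>t. bump a a' p 0 t * inner g (v' t)) - integral {a..c} (\<lambda>t. bump b b' q 0 t * inner g (v' t))"
    by (intro Henstock_Kurzweil_Integration.integral_diff integrable_continuous_interval continuous_on_mult cb cu ord)
  moreover have "(\<lambda>t. bump a a' p 0 t * inner g (v' t) - bump b b' q 0 t * inner g (v' t)) = (\<lambda>t. inner g (v' t) * \<psi>' t)"
    by (auto simp: \<psi>'_def algebra_simps)
  ultimately show ?thesis using integral_unique[OF I1] lhs unfolding \<psi>_def by simp
qed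

text \<open>Let the steps \<open>R\<close> at \<open>a\<close> and \<open>Q\<close> at \<open>b\<close> become infinitely steep. Then \<open>R - Q\<close> tends to the indicator
  function of the interval, boundedly, while the derivatives of \<open>R\<close> and \<open>Q\<close> concentrate at \<open>a\<close> and \<open>b\<close>.\<close>

lemma W22_loc_integral_second_derivative:
  fixes v :: "real \<Rightarrow> 'h::real_inner"
  assumes W: "W22_loc {0<..} v v1 v2"
    and v': "\<And>z. z > 0 \<Longrightarrow> (v has_vector_derivative v' z) (at z)" and cont: "continuous_on {0<..} v'"
    and ab: "0 < a" "a < b"
  shows "integral\<^sup>L (lebesgue_on {a..b}) (\<lambda>t. inner g (v2 t)) = inner g (v' b) - inner g (v' a)"
proof -
  define c where "c = b + 1"
  define \<delta> where "\<delta> n = min (1 / real (Suc n)) (min 1 (b - a))" for n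
  have \<delta>: "\<delta> n > 0" "\<delta> n \<le> 1" "a + \<delta> n \<le> b" for n
  proof -
    show "\<delta> n > 0" "\<delta> n \<le> 1" using ab by (auto simp: \<delta>_def)
    have "\<delta> n \<le> b - a" unfolding \<delta>_def by (simp only: min.cobounded2 min.coboundedI2)
    then show "a + \<delta> n \<le> b" by simp
  qed
  have \<delta>0: "\<delta> \<longlonglongrightarrow> 0"
  proof (rule tendsto_sandwich[OF _ _ tendsto_const LIMSEQ_Suc[OF lim_1_over_n]])
    show "\<forall>\<^sub>F n in sequentially. 0 \<le> \<delta> n" using \<delta>(1) by (simp add: less_imp_le)
    show "\<forall>\<^sub>F n in sequentially. \<delta> n \<le> 1 / of_nat (Suc n)" by (simp add: \<delta>_def)
  qed
  have step: "\<exists>R p. (\<forall>x. (R has_real_derivative bump l (l + \<delta> n) p 0 x) (at x)) \<and>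
      (\<forall>x. bump l (l + \<delta> n) p 0 x \<ge> 0) \<and> (\<forall>x\<le>l. R x = 0) \<and> (\<forall>x\<ge>l + \<delta> n. R x = 1) \<and> (\<forall>x. 0 \<le> R x \<and> R x \<le> 1)" for l n
  proof -
    have "l < l + \<delta> n" using \<delta>(1) by simp
    then show ?thesis by (rule smooth_step_exists) blast
  qed
  obtain R p where R: "\<And>n x. (R n has_real_derivative bump a (a + \<delta> n) (p n) 0 x) (at x)"
    "\<And>n x. bump a (a + \<delta> n) (p n) 0 x \<ge> 0" "\<And>n x. x \<le> a \<Longrightarrow> R n x = 0"
    "\<And>n x. x \<ge> a + \<delta> n \<Longrightarrow> R n x = 1" "\<And>n x. 0 \<le> R n x \<and> R n x \<le> 1"
    using step[of a] by metis
  obtain Q q where Q: "\<And>n x. (Q n has_real_derivative bump b (b + \<delta> n) (q n) 0 x) (at x)"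
    "\<And>n x. bump b (b + \<delta> n) (q n) 0 x \<ge> 0" "\<And>n x. x \<le> b \<Longrightarrow> Q n x = 0"
    "\<And>n x. x \<ge> b + \<delta> n \<Longrightarrow> Q n x = 1" "\<And>n x. 0 \<le> Q n x \<and> Q n x \<le> 1"
    using step[of b] by metis
  define f where "f = (\<lambda>t. inner g (v2 t))"
  define u where "u = (\<lambda>t. inner g (v' t))"
  have L2: "L2_loc {0<..} v2" using W unfolding W22_loc_def by simp
  have f: "integrable (lebesgue_on {a..c}) f" unfolding f_def by (rule L2_loc_integrable_norm(2)[OF L2 ab(1)])
  have cb: "continuous_on S (bump l h r 0)" if "l < h" for S l h r
    using bump_has_derivative[OF that, of r 0] by (metis DERIV_isCont continuous_at_imp_continuous_on)
  have cu: "continuous_on S u" if "S \<subseteq> {0<..}" for S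
    unfolding u_def by (intro continuous_intros continuous_on_subset[OF cont that])
  have int1: "(bump l (l + \<delta> n) r 0 has_integral 1) {l..c}"
    if "\<And>x. (S has_real_derivative bump l (l + \<delta> n) r 0 x) (at x)" "S l = 0" "S c = 1" "l \<le> c" for l n r S
    using fundamental_theorem_of_calculus[of l c S "bump l (l + \<delta> n) r 0"] that
    by (auto simp: has_real_derivative_iff_has_vector_derivative intro: has_vector_derivative_at_within)
  have limR: "(\<lambda>n. integral {a..c} (\<lambda>t. bump a (a + \<delta> n) (p n) 0 t * u t)) \<longlonglongrightarrow> u a"
  proof (rule approximate_identity_right[OF _ _ _ _ _ _ \<delta>0])
    show "(bump a (a + \<delta> n) (p n) 0 has_integral 1) {a..c}" for n
      by (rule int1[OF R(1)]) (use R(3,4) \<delta>[of n] ab in \<open>auto simp: c_def\<close>)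
  qed (use R(2) ab \<delta> in \<open>auto simp: c_def bump_eq_0 intro!: cu cb\<close>)
  have "(\<lambda>n. integral {b..c} (\<lambda>t. bump b (b + \<delta> n) (q n) 0 t * u t)) \<longlonglongrightarrow> u b"
  proof (rule approximate_identity_right[OF _ _ _ _ _ _ \<delta>0])
    show "(bump b (b + \<delta> n) (q n) 0 has_integral 1) {b..c}" for n
      by (rule int1[OF Q(1)]) (use Q(3,4) \<delta>[of n] ab in \<open>auto simp: c_def\<close>)
  qed (use Q(2) ab \<delta> in \<open>auto simp: c_def bump_eq_0 intro!: cu cb\<close>)
  moreover have "integral {b..c} (\<lambda>t. bump b (b + \<delta> n) (q n) 0 t * u t)
      = integral {a..c} (\<lambda>t. bump b (b + \<delta> n) (q n) 0 t * u t)" for n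
  proof (rule integral_unique, rule has_integral_shrink)
    show "((\<lambda>t. bump b (b + \<delta> n) (q n) 0 t * u t) has_integral
        integral {a..c} (\<lambda>t. bump b (b + \<delta> n) (q n) 0 t * u t)) {a..c}"
      by (intro integrable_integral integrable_continuous_interval continuous_on_mult cb cu)
        (use \<delta> ab in auto)
  qed (use ab in \<open>auto simp: bump_eq_0\<close>)
  ultimately have limQ: "(\<lambda>n. integral {a..c} (\<lambda>t. bump b (b + \<delta> n) (q n) 0 t * u t)) \<longlonglongrightarrow> u b" by simp
  have dual: "integral\<^sup>L (lebesgue_on {a..c}) (\<lambda>t. (R n t - Q n t) * f t)
      = integral {a..c} (\<lambda>t. bump b (b + \<delta> n) (q n) 0 t * u t) - integral {a..c} (\<lambda>t. bump a (a + \<delta> n) (p n) 0 t * u t)" for n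
    unfolding f_def u_def
    by (rule step_difference_duality[OF W v' cont])
      (use ab \<delta>[of n] R(1,3,4) Q(1,3,4) in \<open>auto simp: c_def\<close>)
  have lim1: "(\<lambda>n. integral\<^sup>L (lebesgue_on {a..c}) (\<lambda>t. (R n t - Q n t) * f t)) \<longlonglongrightarrow> u b - u a"
    unfolding dual by (intro tendsto_diff limR limQ)
  have sub: "{a..b} \<subseteq> {a..c}" by (auto simp: c_def)
  have lim2: "(\<lambda>n. integral\<^sup>L (lebesgue_on {a..c}) (\<lambda>t. (R n t - Q n t) * f t))
      \<longlonglongrightarrow> integral\<^sup>L (lebesgue_on {a..c}) (\<lambda>t. if t \<in> {a..b} then f t else 0)"
  proof (rule integral_dominated_convergence[where w = "\<lambda>t. norm (f t)"])
    have fm: "f \<in> borel_measurable (lebesgue_on {a..c})" using f by auto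
    show "(\<lambda>t. if t \<in> {a..b} then f t else 0) \<in> borel_measurable (lebesgue_on {a..c})"
      by (rule measurable_If_set[OF fm]) (use sub in \<open>auto simp: sets_restrict_space_iff\<close>)
    show "(\<lambda>t. (R n t - Q n t) * f t) \<in> borel_measurable (lebesgue_on {a..c})" for n
    proof (intro borel_measurable_times fm continuous_imp_measurable_on_sets_lebesgue)
      show "continuous_on {a..c} (\<lambda>t. R n t - Q n t)"
        by (intro continuous_on_diff continuous_at_imp_continuous_on ballI)
          (use R(1) Q(1) DERIV_isCont in blast)+
    qed auto
    show "integrable (lebesgue_on {a..c}) (\<lambda>t. norm (f t))" using f by auto
    show "AE t in lebesgue_on {a..c}. norm ((R n t - Q n t) * f t) \<le> norm (f t)" for n
    proof (rule AE_I2)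
      fix t
      have "\<bar>R n t - Q n t\<bar> \<le> 1" using R(5)[of n t] Q(5)[of n t] by linarith
      then show "norm ((R n t - Q n t) * f t) \<le> norm (f t)" by (simp add: abs_mult mult_left_le_one_le)
    qed
    \<comment> \<open>At \<open>t = a\<close> all steps vanish, so the pointwise limit is \<open>0\<close> and not \<open>f a\<close>.\<close>
    have "AE t in lebesgue. t \<noteq> a" by (intro AE_completion AE_lborel_singleton)
    then have "AE t in lebesgue. t \<in> {a..c} \<longrightarrow> t \<noteq> a" by eventually_elim simp
    then have "AE t in lebesgue_on {a..c}. t \<noteq> a" by (simp add: AE_restrict_space_iff)
    then have "AE t in lebesgue_on {a..c}. t \<noteq> a \<and> t \<in> {a..c}"
      using AE_space[of "lebesgue_on {a..c}"] by eventually_elim simp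
    then show "AE t in lebesgue_on {a..c}. (\<lambda>n. (R n t - Q n t) * f t) \<longlonglongrightarrow> (if t \<in> {a..b} then f t else 0)"
    proof eventually_elim
      case (elim t)
      then have t: "a < t" by auto
      have "\<forall>\<^sub>F n in sequentially. \<delta> n < t - a" using order_tendstoD(2)[OF \<delta>0] t by simp
      then have R1: "\<forall>\<^sub>F n in sequentially. R n t = 1" by eventually_elim (rule R(4), simp)
      show ?case
      proof (cases "t \<le> b")
        case True
        have "\<forall>\<^sub>F n in sequentially. (R n t - Q n t) * f t = f t"
          using R1 by eventually_elim (simp add: Q(3)[OF True])
        then show ?thesis using True t by (simp add: tendsto_eventually)
      next
        case False
        then have "\<forall>\<^sub>F n in sequentially. \<delta> n < t - b" using order_tendstoD(2)[OF \<delta>0] by simp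
        with R1 have "\<forall>\<^sub>F n in sequentially. (R n t - Q n t) * f t = 0"
        proof eventually_elim
          case (elim n)
          then show ?case using Q(4)[of n t] by simp
        qed
        then show ?thesis using False by (simp add: tendsto_eventually)
      qed
    qed
  qed
  have "integral\<^sup>L (lebesgue_on {a..c}) (\<lambda>t. if t \<in> {a..b} then f t else 0) = integral\<^sup>L (lebesgue_on {a..b}) f"
    by (rule Lebesgue_Measure.integral_restrict) (use sub in auto)
  with LIMSEQ_unique[OF lim1 lim2] show ?thesis unfolding f_def u_def by simp
qed

section \<open>Convexity of the envelope along a difference of solutions\<close>

text \<open>The points up to which \<open>F\<close> has lost at most \<open>\<eta>\<close> per unit length form a compact set. Its maximum is
  \<open>\<beta>\<close>, since \<open>step\<close> leads from any smaller member to a larger one.\<close>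

lemma le_if_right_lower_derivative_nonneg:
  fixes F :: "real \<Rightarrow> real"
  assumes cont: "continuous_on {\<alpha>..\<beta>} F" and le: "\<alpha> \<le> \<beta>"
    and step: "\<And>a \<eta>. \<alpha> \<le> a \<Longrightarrow> a < \<beta> \<Longrightarrow> \<eta> > 0 \<Longrightarrow> \<exists>b. a < b \<and> b \<le> \<beta> \<and> F a - \<eta> * (b - a) \<le> F b"
  shows "F \<alpha> \<le> F \<beta>"
proof (rule field_le_epsilon)
  fix e :: real assume e: "e > 0"
  define \<eta> where "\<eta> = e / (\<beta> - \<alpha> + 1)"
  have \<eta>: "\<eta> > 0" using e le by (simp add: \<eta>_def)
  define S where "S = {x \<in> {\<alpha>..\<beta>}. F x + \<eta> * (x - \<alpha>) \<in> {F \<alpha>..}}"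
  have "continuous_on {\<alpha>..\<beta>} (\<lambda>x. F x + \<eta> * (x - \<alpha>))" by (intro continuous_intros cont)
  then have "closed ({\<alpha>..\<beta>} \<inter> (\<lambda>x. F x + \<eta> * (x - \<alpha>)) -` {F \<alpha>..})"
    by (rule continuous_closed_preimage) auto
  moreover have "{\<alpha>..\<beta>} \<inter> (\<lambda>x. F x + \<eta> * (x - \<alpha>)) -` {F \<alpha>..} = S" by (auto simp: S_def)
  ultimately have "closed S" by simp
  then have "compact S"
    by (rule compact_eq_bounded_closed[THEN iffD2, OF conjI, rotated])
      (rule bounded_subset[OF bounded_closed_interval[of \<alpha> \<beta>]], auto simp: S_def)
  moreover have "S \<noteq> {}" using le by (auto simp: S_def)
  ultimately obtain c where c: "c \<in> S" "\<And>x. x \<in> S \<Longrightarrow> x \<le> c"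
    using compact_attains_sup by metis
  have "c = \<beta>"
  proof (rule ccontr)
    assume "c \<noteq> \<beta>"
    then have "\<alpha> \<le> c" "c < \<beta>" using c(1) by (auto simp: S_def)
    then obtain b where b: "c < b" "b \<le> \<beta>" "F c - \<eta> * (b - c) \<le> F b" using step \<eta> by blast
    have "b \<in> S" using c(1) b by (auto simp: S_def algebra_simps)
    with c(2) b(1) show False by fastforce
  qed
  then have "F \<alpha> \<le> F \<beta> + \<eta> * (\<beta> - \<alpha>)" using c(1) by (simp add: S_def)
  also have "\<eta> * (\<beta> - \<alpha>) \<le> e" using e le by (simp add: \<eta>_def field_simps)
  finally show "F \<alpha> \<le> F \<beta> + e" by simp
qed

lemma difference_quotient_tendsto_right:
  fixes d :: "real \<Rightarrow> 'h::real_normed_vector"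
  assumes "(d has_vector_derivative l) (at a)"
  shows "((\<lambda>b. (1 / (b - a)) *\<^sub>R (d b - d a)) \<longlongrightarrow> l) (at_right a)"
proof -
  have "((\<lambda>b. norm (d b - d a - (b - a) *\<^sub>R l) / norm (b - a)) \<longlongrightarrow> 0) (at a)"
    using assms unfolding has_vector_derivative_def has_derivative_iff_norm by simp
  then have "((\<lambda>b. norm (d b - d a - (b - a) *\<^sub>R l) / norm (b - a)) \<longlongrightarrow> 0) (at_right a)"
    by (rule tendsto_mono[rotated]) (simp add: at_le)
  moreover have "\<forall>\<^sub>F b in at_right a. norm (d b - d a - (b - a) *\<^sub>R l) / norm (b - a)
      = norm ((1 / (b - a)) *\<^sub>R (d b - d a) - l)"
    using eventually_at_right_less[of a]
  proof eventually_elim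
    case (elim b)
    have "(1 / (b - a)) *\<^sub>R (d b - d a) - l = (1 / (b - a)) *\<^sub>R (d b - d a - (b - a) *\<^sub>R l)"
      using elim by (simp add: algebra_simps flip: scaleR_left_distrib scaleR_left_diff_distrib diff_divide_distrib)
    then show ?case using elim by simp
  qed
  ultimately have "((\<lambda>b. norm ((1 / (b - a)) *\<^sub>R (d b - d a) - l)) \<longlongrightarrow> 0) (at_right a)"
    by (rule Lim_transform_eventually)
  then show ?thesis by (simp add: tendsto_norm_zero_iff LIM_zero_iff)
qed

text \<open>The situation of the proof for one envelope: \<open>d\<close> is the difference of two solutions and \<open>e\<close> its weak
  second derivative, which enters only through its components \<open>g \<bullet> e\<close> and an integrable majorant \<open>m\<close>
  of its norm.\<close>

locale gradient_accretive_trajectory = closed_convex_function D f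
  for D :: "'h::{real_inner, complete_space} set" and f :: "'h \<Rightarrow> real" +
  fixes \<epsilon> :: real and d d' e :: "real \<Rightarrow> 'h" and m :: "real \<Rightarrow> real"
  assumes \<epsilon>: "\<epsilon> > 0"
    and deriv: "\<And>z. z > 0 \<Longrightarrow> (d has_vector_derivative d' z) (at z)"
    and cont: "continuous_on {0..} d" and cont': "continuous_on {0..} d'"
    and second: "\<And>a b g. 0 < a \<Longrightarrow> a < b \<Longrightarrow> integrable (lebesgue_on {a..b}) (\<lambda>t. inner g (e t))"
      "\<And>a b g. 0 < a \<Longrightarrow> a < b \<Longrightarrow>
        integral\<^sup>L (lebesgue_on {a..b}) (\<lambda>t. inner g (e t)) = inner g (d' b) - inner g (d' a)"
    and bound: "\<And>t. norm (e t) \<le> m t" "\<And>a b. 0 < a \<Longrightarrow> integrable (lebesgue_on {a..b}) m"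
    and acc: "AE t in lebesgue_on {0<..}. inner (envelope_gradient \<epsilon> (d t)) (e t) \<ge> 0"
begin

abbreviation G :: "'h \<Rightarrow> 'h" where "G \<equiv> envelope_gradient \<epsilon>"

text \<open>The derivative of the envelope along \<open>d\<close>.\<close>

definition slope :: "real \<Rightarrow> real" where
  "slope z = inner (G (d z)) (d' z)"

lemma continuous_on_slope: "continuous_on {0..} slope"
proof -
  have "continuous_on UNIV G" using isCont_envelope_gradient[OF \<epsilon>] by (simp add: continuous_at_imp_continuous_on)
  then have "continuous_on {0..} (\<lambda>z. G (d z))" by (rule continuous_on_compose2[OF _ cont]) auto
  then show ?thesis unfolding slope_def by (intro continuous_intros cont')
qed

text \<open>The increment of \<open>G(d) \<bullet> d'\<close> over \<open>[a, b]\<close> is \<open>(G(d b) - G(d a)) \<bullet> d' b + G(d a) \<bullet> (d' b - d' a)\<close>. If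
  \<open>d' b\<close> is replaced by the difference quotient \<open>q b\<close>, then the first term is nonnegative by monotonicity
  of \<open>G\<close>; the error is of order \<open>(b - a) \<parallel>d' b - q b\<parallel>\<close>. The second term is the integral of
  \<open>G(d a) \<bullet> e\<close>; if \<open>G(d a)\<close> is replaced by \<open>G(d t)\<close>, then the integrand is nonnegative, and the error
  is of order \<open>b - a\<close> times the integral of \<open>m\<close> over \<open>[a, b]\<close>. Both errors are \<open>o(b - a)\<close> as \<open>b\<close> tends
  to \<open>a\<close>, only the Lipschitz bound for \<open>G\<close> being used.\<close>

lemma slope_mono:
  assumes "0 < \<alpha>" "\<alpha> \<le> \<beta>"
  shows "slope \<alpha> \<le> slope \<beta>"
proof (rule le_if_right_lower_derivative_nonneg[where F = slope])
  show "continuous_on {\<alpha>..\<beta>} slope" by (rule continuous_on_subset[OF continuous_on_slope]) (use assms in auto)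
  show "\<alpha> \<le> \<beta>" by fact
  fix a \<eta> :: real assume a: "\<alpha> \<le> a" "a < \<beta>" and \<eta>: "\<eta> > 0"
  have a0: "a > 0" using a assms by simp
  define q where "q b = (1 / (b - a)) *\<^sub>R (d b - d a)" for b
  define K where "K = norm (d' a) + 1"
  have q: "(q \<longlongrightarrow> d' a) (at_right a)"
    unfolding q_def by (rule difference_quotient_tendsto_right[OF deriv[OF a0]])
  have qd: "d b - d a = (b - a) *\<^sub>R q b" if "b > a" for b using that by (simp add: q_def)
  have "continuous_on {0<..} d'" by (rule continuous_on_subset[OF cont']) auto
  then have "isCont d' a" using a0 by (simp add: continuous_on_eq_continuous_at)
  then have d'a: "(d' \<longlongrightarrow> d' a) (at_right a)"
    unfolding isCont_def by (rule tendsto_mono[rotated]) (simp add: at_le)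
  have "((\<lambda>b. norm (q b) / \<epsilon> * norm (d' b - q b)) \<longlongrightarrow> norm (d' a) / \<epsilon> * norm (d' a - d' a)) (at_right a)"
    by (intro tendsto_intros q d'a) (use \<epsilon> in auto)
  then have ev1: "\<forall>\<^sub>F b in at_right a. norm (q b) / \<epsilon> * norm (d' b - q b) < \<eta> / 2"
    by (rule order_tendstoD(2)) (use \<eta> in simp)
  have "\<forall>\<^sub>F b in at_right a. norm (q b) < K"
    using order_tendstoD(2)[OF tendsto_norm[OF q], of K] by (simp add: K_def)
  then obtain h where h: "h > a" "\<And>b. a < b \<Longrightarrow> b < h \<Longrightarrow> norm (q b) < K"
    unfolding eventually_at_right_field by blast
  have "continuous_on {a..\<beta>} (\<lambda>b. integral\<^sup>L (lebesgue_on {a..b}) m)"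
    by (rule indefinite_integral_continuous_real[OF bound(2)[OF a0]])
  then have "((\<lambda>b. integral\<^sup>L (lebesgue_on {a..b}) m) \<longlongrightarrow> integral\<^sup>L (lebesgue_on {a..a}) m) (at a within {a..\<beta>})"
    by (rule continuous_on_def[THEN iffD1, rule_format]) (use a in auto)
  moreover have "at a within {a..\<beta>} = at_right a" by (rule at_within_Icc_at_right[OF a(2)])
  moreover have "integral\<^sup>L (lebesgue_on {a..a}) m = 0"
    using lebesgue_integral_eq_integral[OF bound(2)[OF a0, of a]] by simp
  ultimately have "((\<lambda>b. K / \<epsilon> * integral\<^sup>L (lebesgue_on {a..b}) m) \<longlongrightarrow> K / \<epsilon> * 0) (at_right a)"
    by (intro tendsto_mult_left) simp
  then have ev2: "\<forall>\<^sub>F b in at_right a. K / \<epsilon> * integral\<^sup>L (lebesgue_on {a..b}) m < \<eta> / 2"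
    by (rule order_tendstoD(2)) (use \<eta> in simp)
  have "\<forall>\<^sub>F b in at_right a. a < b \<and> b < min h \<beta>"
    using h(1) a unfolding eventually_at_right_field by (intro exI[of _ "min h \<beta>"]) auto
  with ev1 ev2 have "\<forall>\<^sub>F b in at_right a. a < b \<and> b \<le> \<beta> \<and> slope a - \<eta> * (b - a) \<le> slope b"
  proof eventually_elim
    case (elim b)
    then have b: "a < b" "b < h" "b < \<beta>" by auto
    have t1: "inner (G (d b) - G (d a)) (d' b) \<ge> - (b - a) * (\<eta> / 2)"
    proof -
      have "0 \<le> inner (G (d b) - G (d a)) (d b - d a)" by (rule envelope_gradient_monotone[OF \<epsilon>])
      then have "0 \<le> inner (G (d b) - G (d a)) (q b)"
        using b(1) by (simp add: qd zero_le_mult_iff)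
      then have "inner (G (d b) - G (d a)) (d' b) \<ge> inner (G (d b) - G (d a)) (d' b - q b)"
        by (simp add: inner_diff_right)
      moreover have "\<bar>inner (G (d b) - G (d a)) (d' b - q b)\<bar> \<le> norm (G (d b) - G (d a)) * norm (d' b - q b)"
        by (rule Cauchy_Schwarz_ineq2)
      moreover have "\<dots> \<le> (norm (d b - d a) / \<epsilon>) * norm (d' b - q b)"
        by (intro mult_right_mono envelope_gradient_lipschitz[OF \<epsilon>]) simp
      moreover have "\<dots> = (b - a) * (norm (q b) / \<epsilon> * norm (d' b - q b))"
        using b(1) by (simp add: qd)
      moreover have "\<dots> \<le> (b - a) * (\<eta> / 2)"
        by (intro mult_left_mono) (use elim b in auto)
      ultimately show ?thesis by linarith
    qed
    have t2: "inner (G (d a)) (d' b) - inner (G (d a)) (d' a) \<ge> - (b - a) * (\<eta> / 2)"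
    proof -
      define C where "C = - (K / \<epsilon> * (b - a))"
      have dist: "norm (d t - d a) \<le> K * (b - a)" if "t \<in> {a..b}" for t
      proof (cases "t = a")
        case False
        then have "a < t" "t < h" using that b by auto
        then have "norm (d t - d a) \<le> (t - a) * K"
          using h(2)[of t] by (simp add: qd)
        also have "\<dots> \<le> (b - a) * K" using that by (intro mult_right_mono) (auto simp: K_def)
        finally show ?thesis by (simp add: mult.commute)
      qed (use b in \<open>simp add: K_def\<close>)
      have sub: "{a..b} \<subseteq> {0<..}" using a0 by auto
      have "AE t in lebesgue. t \<in> {0<..} \<longrightarrow> inner (G (d t)) (e t) \<ge> 0"
        using acc by (simp add: AE_restrict_space_iff)
      then have "AE t in lebesgue. t \<in> {a..b} \<longrightarrow> C * m t \<le> inner (G (d a)) (e t)"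
      proof eventually_elim
        case (elim t)
        show ?case
        proof
          assume t: "t \<in> {a..b}"
          then have "inner (G (d t)) (e t) \<ge> 0" using elim sub by auto
          then have "inner (G (d a)) (e t) \<ge> inner (G (d a) - G (d t)) (e t)"
            by (simp add: inner_diff_left)
          moreover have "\<bar>inner (G (d a) - G (d t)) (e t)\<bar> \<le> norm (G (d a) - G (d t)) * norm (e t)"
            by (rule Cauchy_Schwarz_ineq2)
          moreover have "\<dots> \<le> (K / \<epsilon> * (b - a)) * m t"
          proof (rule mult_mono)
            have "norm (G (d a) - G (d t)) \<le> norm (d a - d t) / \<epsilon>"
              by (rule envelope_gradient_lipschitz[OF \<epsilon>])
            also have "\<dots> \<le> K * (b - a) / \<epsilon>"
              using dist[OF t] \<epsilon> by (intro divide_right_mono) (auto simp: norm_minus_commute)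
            finally show "norm (G (d a) - G (d t)) \<le> K / \<epsilon> * (b - a)" by simp
          qed (use bound(1) b \<epsilon> in \<open>auto simp: K_def\<close>)
          ultimately show "C * m t \<le> inner (G (d a)) (e t)" unfolding C_def by simp
        qed
      qed
      then have ae: "AE t in lebesgue_on {a..b}. C * m t \<le> inner (G (d a)) (e t)"
        by (simp add: AE_restrict_space_iff)
      have "C * integral\<^sup>L (lebesgue_on {a..b}) m = integral\<^sup>L (lebesgue_on {a..b}) (\<lambda>t. C * m t)" by simp
      also have "\<dots> \<le> integral\<^sup>L (lebesgue_on {a..b}) (\<lambda>t. inner (G (d a)) (e t))"
        by (rule integral_mono_AE[OF _ second(1)[OF a0 b(1)] ae])
          (intro integrable_mult_right bound(2)[OF a0])
      also have "\<dots> = inner (G (d a)) (d' b) - inner (G (d a)) (d' a)" by (rule second(2)[OF a0 b(1)])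
      finally have "inner (G (d a)) (d' b) - inner (G (d a)) (d' a) \<ge> - ((b - a) * (K / \<epsilon> * integral\<^sup>L (lebesgue_on {a..b}) m))"
        by (simp add: C_def algebra_simps)
      moreover have "(b - a) * (K / \<epsilon> * integral\<^sup>L (lebesgue_on {a..b}) m) \<le> (b - a) * (\<eta> / 2)"
        by (intro mult_left_mono) (use elim b in auto)
      ultimately show ?thesis by linarith
    qed
    have "slope b - slope a = inner (G (d b) - G (d a)) (d' b) + (inner (G (d a)) (d' b) - inner (G (d a)) (d' a))"
      by (simp add: slope_def inner_diff_left)
    with t1 t2 have "slope b - slope a \<ge> - (b - a) * (\<eta> / 2) + - (b - a) * (\<eta> / 2)" by linarith
    then have "slope b - slope a \<ge> - (\<eta> * (b - a))" by (simp add: field_simps)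
    then show ?case using b by auto
  qed
  from eventually_happens'[OF _ this] show "\<exists>b. a < b \<and> b \<le> \<beta> \<and> slope a - \<eta> * (b - a) \<le> slope b" by simp
qed

text \<open>The integral identity for \<open>d'\<close> is available only away from \<open>0\<close>; the initial slope is reached by
  continuity.\<close>

lemma slope_0_le:
  assumes "z > 0"
  shows "slope 0 \<le> slope z"
proof -
  have "(slope \<longlongrightarrow> slope 0) (at 0 within {0..z})"
    using continuous_on_subset[OF continuous_on_slope, of "{0..z}"] assms by (auto simp: continuous_on_def)
  then have lim: "(slope \<longlongrightarrow> slope 0) (at_right 0)" by (simp add: at_within_Icc_at_right[OF assms])
  have "\<forall>\<^sub>F \<alpha> in at_right 0. slope \<alpha> \<le> slope z"
    unfolding eventually_at_right_field by (intro exI[of _ z]) (use assms slope_mono in auto)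
  from tendsto_upperbound[OF lim this] show ?thesis by simp
qed

text \<open>A positive initial slope would be a lower bound for all later slopes, and the envelope would grow
  at least linearly along \<open>d\<close>; but it is bounded on bounded sets, as a fixed \<open>y \<in> D\<close> may serve as
  competitor.\<close>

lemma slope_0_nonpos:
  assumes bdd: "\<And>z. \<exists>\<zeta>>z. norm (d \<zeta>) \<le> C"
  shows "slope 0 \<le> 0"
proof (rule ccontr)
  assume "\<not> slope 0 \<le> 0"
  then have pos: "slope 0 > 0" by simp
  define E where "E = moreau_envelope \<epsilon>"
  have E: "(E has_derivative (\<lambda>h. inner (G x) h)) (at x)" for x
    unfolding E_def by (rule moreau_envelope_has_derivative[OF \<epsilon>])
  have grow: "E (d z) \<ge> E (d 0) + z * slope 0" if z: "z > 0" for z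
  proof -
    have "continuous_on UNIV E"
      by (intro continuous_at_imp_continuous_on ballI has_derivative_continuous[OF E])
    then have c: "continuous_on {0..z} (\<lambda>t. E (d t))"
      by (rule continuous_on_compose2) (use continuous_on_subset[OF cont] in auto)
    have D: "((\<lambda>t. E (d t)) has_real_derivative slope t) (at t)" if "t > 0" for t
      using vector_derivative_diff_chain_within[OF deriv[OF that] has_derivative_at_withinI[OF E]]
      by (simp add: has_real_derivative_iff_has_vector_derivative slope_def o_def)
    obtain l \<xi> where \<xi>: "0 < \<xi>" "\<xi> < z" "((\<lambda>t. E (d t)) has_real_derivative l) (at \<xi>)"
      "E (d z) - E (d 0) = (z - 0) * l"
      using MVT[OF z c] D by (metis real_differentiable_def)
    have "l = slope \<xi>" using DERIV_unique[OF \<xi>(3) D[OF \<xi>(1)]] .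
    then have "z * slope 0 \<le> z * l" using slope_0_le[OF \<xi>(1)] z by simp
    then show ?thesis using \<xi>(4) by simp
  qed
  obtain y where y: "y \<in> D" using nonempty by auto
  define M where "M = f y + (C + norm y)\<^sup>2 / (2 * \<epsilon>)"
  obtain \<zeta> where \<zeta>: "\<zeta> > max 0 ((M - E (d 0)) / slope 0)" "norm (d \<zeta>) \<le> C" using bdd by blast
  have "norm (d \<zeta> - y) \<le> C + norm y" using \<zeta>(2) norm_triangle_ineq4[of "d \<zeta>" y] by linarith
  then have "(norm (d \<zeta> - y))\<^sup>2 / (2 * \<epsilon>) \<le> (C + norm y)\<^sup>2 / (2 * \<epsilon>)"
    using \<epsilon> by (intro divide_right_mono power_mono) auto
  then have "E (d \<zeta>) \<le> M" using moreau_envelope_le[OF \<epsilon> y, of "d \<zeta>"] unfolding E_def M_def by linarith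
  then have "\<zeta> * slope 0 \<le> M - E (d 0)" using grow[of \<zeta>] \<zeta>(1) by simp
  then have "\<zeta> \<le> (M - E (d 0)) / slope 0" using pos by (simp add: field_simps)
  then show False using \<zeta>(1) by simp
qed

end

section \<open>The Dirichlet-to-Neumann operator\<close>

lemma AE_lebesgue_on_half_line_frequently:
  assumes "AE t in lebesgue_on {0<..}. P t"
  shows "\<exists>\<zeta>>z::real. P \<zeta>"
proof (rule ccontr)
  assume *: "\<not> (\<exists>\<zeta>>z. P \<zeta>)"
  define l where "l = max z 0"
  have "AE t in lebesgue. t \<in> {0<..} \<longrightarrow> P t" using assms by (simp add: AE_restrict_space_iff)
  then have "AE t in lebesgue. t \<notin> {l<..<l + 1}"
    by eventually_elim (use * in \<open>auto simp: l_def\<close>)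
  then have "{l<..<l + 1} \<in> null_sets lebesgue" by (subst AE_iff_null_sets) auto
  then show False by (simp add: null_sets_def)
qed

theorem theorem4p1:
  fixes A :: "('h::{real_inner, complete_space} \<times> 'h) set"
    and \<phi> :: "'h \<Rightarrow> ereal"
    and s :: real
  assumes "maximal_monotone_op A"
    and "0 \<in> Range A"
    and "convex_fun \<phi>" and "proper_fun \<phi>" and "lsc_fun \<phi>"
    and "subdiff_monotone \<phi> A"
    and "0 < s" and "s < 1"
  shows "subdiff_monotone \<phi> (DtN A s)"
proof -
  define D where "D = {x. \<phi> x \<noteq> \<infinity>}"
  define f where "f x = real_of_ereal (\<phi> x)" for x
  interpret closed_convex_function D f
    unfolding D_def f_def by (rule closed_convex_function_ereal) (fact assms)+
  have fin: "\<phi> x = ereal (f x)" if "x \<in> D" for x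
    using that assms(4) unfolding D_def f_def proper_fun_def by (cases "\<phi> x") auto
  have mon: "monotone_op A" using assms(1) by (simp add: maximal_monotone_op_def)
  have res: "\<phi> (u - u') \<le> \<phi> ((u + \<mu> *\<^sub>R w) - (u' + \<mu> *\<^sub>R w'))"
    if "(u, w) \<in> A" "(u', w') \<in> A" "\<mu> > 0" for u w u' w' \<mu>
  proof -
    have "(u + \<mu> *\<^sub>R w, u) \<in> resolvent \<mu> A" "(u' + \<mu> *\<^sub>R w', u') \<in> resolvent \<mu> A"
      using that by (auto simp: resolvent_def id_plus_def)
    then show ?thesis using assms(6) that(3) unfolding subdiff_monotone_def by fast
  qed
  \<comment> \<open>The formal inequality \<open>\<nabla>\<phi>(u - u') \<bullet> (w - w') \<ge> 0\<close>, for the envelopes.\<close>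
  have acc: "inner (envelope_gradient \<epsilon> (u - u')) (w - w') \<ge> 0"
    if A: "(u, w) \<in> A" "(u', w') \<in> A" and \<epsilon>: "\<epsilon> > 0" for u w u' w' \<epsilon>
  proof (rule envelope_gradient_nonneg[OF \<epsilon>])
    fix \<mu> :: real assume \<mu>: "\<mu> > 0"
    have "moreau_envelope \<epsilon> (u - u') \<le> moreau_envelope \<epsilon> ((u + \<mu> *\<^sub>R w) - (u' + \<mu> *\<^sub>R w'))"
    proof (rule envelope_contraction[OF mon maximal_monotone_Range_id_plus[OF assms(1) \<mu>] _ _ A \<epsilon>])
      fix p q p' q'
      assume pq: "(p, q) \<in> A" "(p', q') \<in> A" and in_D: "p + \<mu> *\<^sub>R q - (p' + \<mu> *\<^sub>R q') \<in> D"
      from res[OF pq \<mu>] in_D have "p - p' \<in> D" by (auto simp: D_def)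
      moreover from this res[OF pq \<mu>] in_D have "f (p - p') \<le> f (p + \<mu> *\<^sub>R q - (p' + \<mu> *\<^sub>R q'))"
        by (simp add: fin)
      ultimately show "p - p' \<in> D \<and> f (p - p') \<le> f (p + \<mu> *\<^sub>R q - (p' + \<mu> *\<^sub>R q'))" by blast
    qed (use \<mu> in simp)
    then show "moreau_envelope \<epsilon> (u - u') \<le> moreau_envelope \<epsilon> (u - u' + \<mu> *\<^sub>R (w - w'))"
      by (simp add: algebra_simps)
  qed
  \<comment> \<open>The positive constant in the Neumann data is absorbed into \<open>\<mu>\<close>.\<close>
  have main: "\<phi> (v 0 - w 0) \<le> \<phi> ((v 0 - \<mu> *\<^sub>R v' 0) - (w 0 - \<mu> *\<^sub>R w' 0))"
    if v: "strong_solution A s v" "Linf {0<..} v" "C1_on {0..} v v'"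
      and w: "strong_solution A s w" "Linf {0<..} w" "C1_on {0..} w w'" and \<mu>: "\<mu> > 0"
    for v v' w w' \<mu>
  proof (cases "(v 0 - \<mu> *\<^sub>R v' 0) - (w 0 - \<mu> *\<^sub>R w' 0) \<in> D")
    case True
    define r where "r z = z powr (- ((1 - 2 * s) / s))" for z
    obtain v1 v2 where v2: "W22_loc {0<..} v v1 v2" "AE z in lebesgue_on {0<..}. (v z, r z *\<^sub>R v2 z) \<in> A"
      using v(1) unfolding strong_solution_def r_def by auto
    obtain w1 w2 where w2: "W22_loc {0<..} w w1 w2" "AE z in lebesgue_on {0<..}. (w z, r z *\<^sub>R w2 z) \<in> A"
      using w(1) unfolding strong_solution_def r_def by auto
    have C1: "\<And>z. z > 0 \<Longrightarrow> (y has_vector_derivative y' z) (at z)" "continuous_on {0<..} y'"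
      "continuous_on {0..} y" "continuous_on {0..} y'" if "C1_on {0..} y y'" for y y' :: "real \<Rightarrow> 'h"
    proof -
      have y: "\<And>z. z \<ge> 0 \<Longrightarrow> (y has_vector_derivative y' z) (at z within {0..})" "continuous_on {0..} y'"
        using that unfolding C1_on_def by auto
      show "(y has_vector_derivative y' z) (at z)" if "z > 0" for z
        using y(1)[of z] that at_within_interior[of z "{0..}"] by simp
      show "continuous_on {0..} y" using y(1) by (intro continuous_on_vector_derivative) auto
      show "continuous_on {0..} y'" by fact
      then show "continuous_on {0<..} y'" by (rule continuous_on_subset) auto
    qed
    have L2: "L2_loc {0<..} v2" "L2_loc {0<..} w2" using v2(1) w2(1) unfolding W22_loc_def by auto
    note second_v = W22_loc_integral_second_derivative[OF v2(1) C1(1,2)[OF v(3)]]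
    note second_w = W22_loc_integral_second_derivative[OF w2(1) C1(1,2)[OF w(3)]]
    define d where "d z = v z - w z" for z
    define d' where "d' z = v' z - w' z" for z
    obtain Cv where Cv: "AE t in lebesgue_on {0<..}. norm (v t) \<le> Cv" using v(2) unfolding Linf_def by auto
    obtain Cw where Cw: "AE t in lebesgue_on {0<..}. norm (w t) \<le> Cw" using w(2) unfolding Linf_def by auto
    have "AE t in lebesgue_on {0<..}. norm (d t) \<le> Cv + Cw"
      using Cv Cw
    proof eventually_elim
      case (elim t)
      then show ?case using norm_triangle_ineq4[of "v t" "w t"] unfolding d_def by linarith
    qed
    note bdd = AE_lebesgue_on_half_line_frequently[OF this]
    have "d 0 \<in> D \<and> f (d 0) \<le> f (d 0 - \<mu> *\<^sub>R d' 0)"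
    proof (rule sublevel_of_moreau_envelopes)
      fix \<epsilon> :: real assume \<epsilon>: "\<epsilon> > 0"
      interpret gradient_accretive_trajectory D f \<epsilon> d d' "\<lambda>z. v2 z - w2 z" "\<lambda>z. norm (v2 z) + norm (w2 z)"
      proof
        show "\<epsilon> > 0" by fact
        show "(d has_vector_derivative d' z) (at z)" if "z > 0" for z
          unfolding d_def d'_def by (intro has_vector_derivative_diff C1(1)[OF v(3)] C1(1)[OF w(3)] that)
        show "continuous_on {0..} d" "continuous_on {0..} d'"
          unfolding d_def d'_def by (intro continuous_on_diff C1(3,4)[OF v(3)] C1(3,4)[OF w(3)])+
        show "integrable (lebesgue_on {a..b}) (\<lambda>t. inner g (v2 t - w2 t))" if "0 < a" "a < b" for a b g
          unfolding inner_diff_right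
          by (intro Bochner_Integration.integrable_diff L2_loc_integrable_norm(2) L2 that)
        show "integral\<^sup>L (lebesgue_on {a..b}) (\<lambda>t. inner g (v2 t - w2 t)) = inner g (d' b) - inner g (d' a)"
          if "0 < a" "a < b" for a b g
        proof -
          have "integral\<^sup>L (lebesgue_on {a..b}) (\<lambda>t. inner g (v2 t - w2 t))
              = integral\<^sup>L (lebesgue_on {a..b}) (\<lambda>t. inner g (v2 t)) - integral\<^sup>L (lebesgue_on {a..b}) (\<lambda>t. inner g (w2 t))"
            unfolding inner_diff_right
            by (intro Bochner_Integration.integral_diff L2_loc_integrable_norm(2) L2 that)
          then show ?thesis
            using second_v[OF _ that] second_w[OF _ that] by (simp add: d'_def inner_diff_right)
        qed
        show "norm (v2 t - w2 t) \<le> norm (v2 t) + norm (w2 t)" for t by (rule norm_triangle_ineq4)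
        show "integrable (lebesgue_on {a..b}) (\<lambda>z. norm (v2 z) + norm (w2 z))" if "0 < a" for a b
          by (intro Bochner_Integration.integrable_add L2_loc_integrable_norm(1) L2 that)
        have "AE z in lebesgue_on {0::real<..}. z \<in> {0<..}"
          using AE_space[of "lebesgue_on {0::real<..}"] by simp
        with v2(2) w2(2)
        show "AE t in lebesgue_on {0<..}. inner (envelope_gradient \<epsilon> (d t)) (v2 t - w2 t) \<ge> 0"
        proof eventually_elim
          case (elim t)
          have "0 \<le> inner (envelope_gradient \<epsilon> (d t)) (r t *\<^sub>R v2 t - r t *\<^sub>R w2 t)"
            unfolding d_def by (rule acc[OF elim(1,2) \<epsilon>])
          then have "0 \<le> r t * inner (envelope_gradient \<epsilon> (d t)) (v2 t - w2 t)"
            by (simp add: inner_diff_right right_diff_distrib)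
          moreover have "r t > 0" using elim(3) by (simp add: r_def)
          ultimately show ?case by (simp add: zero_le_mult_iff)
        qed
      qed
      have "inner (envelope_gradient \<epsilon> (d 0)) (d' 0) \<le> 0"
        using slope_0_nonpos[OF bdd] unfolding slope_def .
      then have "inner (envelope_gradient \<epsilon> (d 0)) (d 0 - \<mu> *\<^sub>R d' 0 - d 0) \<ge> 0"
        using \<mu> by (simp add: mult_nonneg_nonpos)
      then have "moreau_envelope \<epsilon> (d 0) \<le> moreau_envelope \<epsilon> (d 0 - \<mu> *\<^sub>R d' 0)"
        using moreau_envelope_ge_tangent[OF \<epsilon>, of "d 0" "d 0 - \<mu> *\<^sub>R d' 0"] by linarith
      also have "\<dots> \<le> f (d 0 - \<mu> *\<^sub>R d' 0)"
      proof -
        have "d 0 - \<mu> *\<^sub>R d' 0 \<in> D" using True by (simp add: d_def d'_def algebra_simps)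
        from moreau_envelope_le[OF \<epsilon> this, of "d 0 - \<mu> *\<^sub>R d' 0"] show ?thesis by simp
      qed
      finally show "moreau_envelope \<epsilon> (d 0) \<le> f (d 0 - \<mu> *\<^sub>R d' 0)" .
    qed
    moreover have "d 0 - \<mu> *\<^sub>R d' 0 = (v 0 - \<mu> *\<^sub>R v' 0) - (w 0 - \<mu> *\<^sub>R w' 0)"
      by (simp add: d_def d'_def algebra_simps)
    ultimately show ?thesis using True fin by (metis d_def ereal_less_eq(3))
  next
    case False
    then have "\<phi> ((v 0 - \<mu> *\<^sub>R v' 0) - (w 0 - \<mu> *\<^sub>R w' 0)) = \<infinity>" by (simp add: D_def)
    then show ?thesis by simp
  qed
  show ?thesis
    unfolding subdiff_monotone_def
  proof (intro allI impI ballI, clarify)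
    fix \<mu> :: real and u x u' x'
    assume \<mu>: "\<mu> > 0" and x: "(u, x) \<in> resolvent \<mu> (DtN A s)" "(u', x') \<in> resolvent \<mu> (DtN A s)"
    define k where "k = (2 * s) powr (1 - 2 * s)"
    have k: "k > 0" using assms(7) by (simp add: k_def)
    have sol: "\<exists>v v'. strong_solution A s v \<and> Linf {0<..} v \<and> C1_on {0..} v v' \<and> v 0 = y \<and> z = v 0 - (\<mu> * k) *\<^sub>R v' 0"
      if "(z, y) \<in> resolvent \<mu> (DtN A s)" for z y
      using that unfolding resolvent_def id_plus_def DtN_def k_def by clarsimp blast
    obtain v v' where v: "strong_solution A s v" "Linf {0<..} v" "C1_on {0..} v v'" "v 0 = x"
      "u = v 0 - (\<mu> * k) *\<^sub>R v' 0" using sol[OF x(1)] by blast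
    obtain y y' where y: "strong_solution A s y" "Linf {0<..} y" "C1_on {0..} y y'" "y 0 = x'"
      "u' = y 0 - (\<mu> * k) *\<^sub>R y' 0" using sol[OF x(2)] by blast
    show "\<phi> (x - x') \<le> \<phi> (u - u')"
      using main[OF v(1-3) y(1-3), of "\<mu> * k"] \<mu> k v(4,5) y(4,5) by simp
  qed
qed

end
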